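(* Let $G$ be a finite non-nilpotent group, let $C\in\mathcal C(G)$, and let $p$ be a prime divisor of $|G|$. (1) If $P$ is a Sylow $p$-subgroup of $G$ contained in $C\cup Z^*(G)$, then $p\mid |C\cup Z^*(G)|$. (2) If $p\mid \gcd(|C|+1,|N_G(C)|)$ and $Z^*(G)=1$, then $C\cup \{1\}$ contains a Sylow $p$-subgroup of $G$.
   Context: For a finite group $G$, $\mathrm{nil}(G)=\{g\in G:\langle g,h\rangle \text{ is nilpotent for all } h\in G\}$, and $Z^*(G)$ is the hypercenter of $G$ (the union of the upper central series); for finite $G$ one has $\mathrm{nil}(G)=Z^*(G)$. For a finite non-nilpotent group $G$, the nilpotent graph $\Gamma_{\mathfrak N}(G)$ is the simple undirected graph with vertex set $G-\mathrm{nil}(G)$ (set difference) in which two distinct vertices $g,h$ are adjacent if and only if $\langle g,h\rangle$ is nilpotent. $\mathcal C(G)$ denotes the set of connected components of $\Gamma_{\mathfrak N}(G)$, each component being identified with its set of vertices. $G$ acts on $\mathcal C(G)$ by conjugation, $g\cdot C=gCg^{-1}$, and $N_G(C)=\{g\in G: gCg^{-1}=C\}$. *)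

theory Defs
  imports "HOL-Algebra.Generated_Groups" "HOL-Algebra.Group_Action" "HOL-Algebra.Sylow"
    "Graph_Theory.Graph_Theory"
begin

section \<open>Upper central series, nilpotency and the hypercenter\<close>

text \<open>
  The term of index \<open>Suc n\<close> consists of the elements that are central modulo the term of
  index \<open>n\<close>; the lemma \<open>upper_central_series_Suc_center_Mod\<close> below states
  this through the factor group.
\<close>

primrec upper_central_series :: "('a, 'b) monoid_scheme \<Rightarrow> nat \<Rightarrow> 'a set" where
  "upper_central_series G 0 = {\<one>\<^bsub>G\<^esub>}"
| "upper_central_series G (Suc n) =
     {x \<in> carrier G. \<forall>y \<in> carrier G.
        x \<otimes>\<^bsub>G\<^esub> y \<otimes>\<^bsub>G\<^esub> inv\<^bsub>G\<^esub> x \<otimes>\<^bsub>G\<^esub> inv\<^bsub>G\<^esub> y \<in> upper_central_series G n}"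

definition hypercenter :: "('a, 'b) monoid_scheme \<Rightarrow> 'a set" where
  "hypercenter G = (\<Union>n. upper_central_series G n)"

definition nilpotent :: "('a, 'b) monoid_scheme \<Rightarrow> bool" where
  "nilpotent G \<longleftrightarrow> (\<exists>n. upper_central_series G n = carrier G)"

lemma (in normal) commutator_mem_iff:
  assumes x: "x \<in> carrier G" and y: "y \<in> carrier G"
  shows "x \<otimes> y \<otimes> inv x \<otimes> inv y \<in> H \<longleftrightarrow>
    (H #> x) \<otimes>\<^bsub>G Mod H\<^esub> (H #> y) = (H #> y) \<otimes>\<^bsub>G Mod H\<^esub> (H #> x)"
proof -
  have "x \<otimes> y \<otimes> inv x \<otimes> inv y = (x \<otimes> y) \<otimes> inv (y \<otimes> x)"
    using x y by (simp add: inv_mult_group m_assoc)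
  moreover have "(x \<otimes> y) \<otimes> inv (y \<otimes> x) \<in> H \<longleftrightarrow> H #> (x \<otimes> y) = H #> (y \<otimes> x)"
  proof
    assume "(x \<otimes> y) \<otimes> inv (y \<otimes> x) \<in> H"
    moreover have "((x \<otimes> y) \<otimes> inv (y \<otimes> x)) \<otimes> (y \<otimes> x) = x \<otimes> y"
      using inv_solve_right[of "(x \<otimes> y) \<otimes> inv (y \<otimes> x)" "x \<otimes> y" "y \<otimes> x"] x y by simp
    ultimately have "x \<otimes> y \<in> H #> (y \<otimes> x)"
      using UN_I[of "(x \<otimes> y) \<otimes> inv (y \<otimes> x)" H "x \<otimes> y" "\<lambda>h. {h \<otimes> (y \<otimes> x)}"]
      by (simp add: r_coset_def)
    then show "H #> (x \<otimes> y) = H #> (y \<otimes> x)"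
      using x y by (metis is_subgroup m_closed repr_independence)
  next
    assume "H #> (x \<otimes> y) = H #> (y \<otimes> x)"
    then have "x \<otimes> y \<in> H #> (y \<otimes> x)"
      using x y by (metis is_subgroup m_closed rcos_self)
    then obtain h where h: "h \<in> H" "x \<otimes> y = h \<otimes> (y \<otimes> x)"
      by (auto simp: r_coset_def)
    then show "(x \<otimes> y) \<otimes> inv (y \<otimes> x) \<in> H"
      using x y subset by (metis inv_solve_right m_closed subsetD)
  qed
  ultimately show ?thesis using x y by (simp add: rcos_sum)
qed

lemma (in group_hom) normal_central_preimage:
  "{x \<in> carrier G. \<forall>y \<in> carrier G. h x \<otimes>\<^bsub>H\<^esub> h y = h y \<otimes>\<^bsub>H\<^esub> h x} \<lhd> G" (is "?K \<lhd> G")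
proof (rule G.normal_invI)
  show "subgroup ?K G"
  proof (rule G.subgroupI)
    show "?K \<subseteq> carrier G" by auto
    have "\<one>\<^bsub>G\<^esub> \<in> ?K" by simp
    then show "?K \<noteq> {}" by blast
  next
    fix x assume x: "x \<in> ?K"
    then have hx: "h x \<in> carrier H" by simp
    have "inv\<^bsub>H\<^esub> h x \<otimes>\<^bsub>H\<^esub> h y = h y \<otimes>\<^bsub>H\<^esub> inv\<^bsub>H\<^esub> h x" if y: "y \<in> carrier G" for y
    proof -
      have "inv\<^bsub>H\<^esub> h x \<otimes>\<^bsub>H\<^esub> h y = inv\<^bsub>H\<^esub> h x \<otimes>\<^bsub>H\<^esub> (h y \<otimes>\<^bsub>H\<^esub> h x) \<otimes>\<^bsub>H\<^esub> inv\<^bsub>H\<^esub> h x"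
        using x y by (simp add: H.m_assoc)
      also have "\<dots> = inv\<^bsub>H\<^esub> h x \<otimes>\<^bsub>H\<^esub> (h x \<otimes>\<^bsub>H\<^esub> h y) \<otimes>\<^bsub>H\<^esub> inv\<^bsub>H\<^esub> h x"
        using x y by simp
      also have "\<dots> = h y \<otimes>\<^bsub>H\<^esub> inv\<^bsub>H\<^esub> h x"
        using hx hom_closed[OF y] by (simp only: H.m_assoc[symmetric] H.m_closed H.inv_closed H.l_inv H.l_one)
      finally show ?thesis .
    qed
    then show "inv\<^bsub>G\<^esub> x \<in> ?K" using x by simp
  next
    fix x y assume x: "x \<in> ?K" and y: "y \<in> ?K"
    then have hx: "h x \<in> carrier H" and hy: "h y \<in> carrier H" by auto
    have "h x \<otimes>\<^bsub>H\<^esub> h y \<otimes>\<^bsub>H\<^esub> h z = h z \<otimes>\<^bsub>H\<^esub> (h x \<otimes>\<^bsub>H\<^esub> h y)" if z: "z \<in> carrier G" for z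
    proof -
      have hz: "h z \<in> carrier H" using z by simp
      have xz: "h x \<otimes>\<^bsub>H\<^esub> h z = h z \<otimes>\<^bsub>H\<^esub> h x" and yz: "h y \<otimes>\<^bsub>H\<^esub> h z = h z \<otimes>\<^bsub>H\<^esub> h y"
        using x y z by blast+
      have "h x \<otimes>\<^bsub>H\<^esub> h y \<otimes>\<^bsub>H\<^esub> h z = h x \<otimes>\<^bsub>H\<^esub> (h z \<otimes>\<^bsub>H\<^esub> h y)"
        by (simp only: H.m_assoc[OF hx hy hz] yz)
      also have "\<dots> = (h z \<otimes>\<^bsub>H\<^esub> h x) \<otimes>\<^bsub>H\<^esub> h y"
        by (simp only: H.m_assoc[OF hx hz hy, symmetric] xz)
      finally show ?thesis by (simp only: H.m_assoc[OF hz hx hy])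
    qed
    moreover have xG: "x \<in> carrier G" and yG: "y \<in> carrier G" using x y by auto
    ultimately show "x \<otimes>\<^bsub>G\<^esub> y \<in> ?K"
      by (intro CollectI conjI ballI) (simp_all only: hom_mult[OF xG yG] G.m_closed[OF xG yG])
  qed
next
  fix x k assume x: "x \<in> carrier G" and k: "k \<in> ?K"
  then have kG: "k \<in> carrier G" and kx: "h k \<otimes>\<^bsub>H\<^esub> h x = h x \<otimes>\<^bsub>H\<^esub> h k" by auto
  have "h (x \<otimes>\<^bsub>G\<^esub> k \<otimes>\<^bsub>G\<^esub> inv\<^bsub>G\<^esub> x) = (h x \<otimes>\<^bsub>H\<^esub> h k) \<otimes>\<^bsub>H\<^esub> inv\<^bsub>H\<^esub> h x"
    using x kG by simp
  also have "\<dots> = (h k \<otimes>\<^bsub>H\<^esub> h x) \<otimes>\<^bsub>H\<^esub> inv\<^bsub>H\<^esub> h x"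
    by (simp only: kx)
  also have "\<dots> = h k"
    using x kG by (simp add: H.m_assoc)
  finally have eq: "h (x \<otimes>\<^bsub>G\<^esub> k \<otimes>\<^bsub>G\<^esub> inv\<^bsub>G\<^esub> x) = h k" .
  have "x \<otimes>\<^bsub>G\<^esub> k \<otimes>\<^bsub>G\<^esub> inv\<^bsub>G\<^esub> x \<in> carrier G" using x kG by simp
  with k show "x \<otimes>\<^bsub>G\<^esub> k \<otimes>\<^bsub>G\<^esub> inv\<^bsub>G\<^esub> x \<in> ?K"
    unfolding mem_Collect_eq eq by blast
qed

lemma (in group) upper_central_series_normal: "upper_central_series G n \<lhd> G"
proof (induction n)
  case 0
  then show ?case by (simp add: one_is_normal)
next
  case (Suc n)
  let ?N = "upper_central_series G n"
  interpret N: normal ?N G by (rule Suc)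
  interpret r: group_hom G "G Mod ?N" "\<lambda>x. ?N #> x"
    using N.r_coset_hom_Mod N.factorgroup_is_group
    by (simp add: group_hom_def group_hom_axioms_def is_group)
  have "upper_central_series G (Suc n) = {x \<in> carrier G. \<forall>y \<in> carrier G.
      (?N #> x) \<otimes>\<^bsub>G Mod ?N\<^esub> (?N #> y) = (?N #> y) \<otimes>\<^bsub>G Mod ?N\<^esub> (?N #> x)}"
    using N.commutator_mem_iff by auto
  then show ?case using r.normal_central_preimage by (simp only:)
qed

lemma (in group) upper_central_series_Suc_center_Mod:
  "upper_central_series G (Suc n) =
     {x \<in> carrier G. \<forall>Y \<in> carrier (G Mod upper_central_series G n).
        (upper_central_series G n #> x) \<otimes>\<^bsub>G Mod upper_central_series G n\<^esub> Y =
        Y \<otimes>\<^bsub>G Mod upper_central_series G n\<^esub> (upper_central_series G n #> x)}"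
  using normal.commutator_mem_iff[OF upper_central_series_normal]
  by (auto simp: FactGroup_def RCOSETS_def)


section \<open>The nilpotent graph\<close>

definition nil :: "('a, 'b) monoid_scheme \<Rightarrow> 'a set" where
  "nil G = {g \<in> carrier G. \<forall>h \<in> carrier G. nilpotent (subgroup_generated G {g, h})}"

text \<open>
  A simple undirected graph is a finite symmetric loop-free digraph given by its set of arcs,
  see \<^locale>\<open>pair_graph\<close>.
\<close>

definition nilpotent_graph :: "('a, 'b) monoid_scheme \<Rightarrow> 'a pair_pre_digraph" where
  "nilpotent_graph G =
     \<lparr> pverts = carrier G - nil G,
       parcs = {(g, h). g \<in> carrier G - nil G \<and> h \<in> carrier G - nil G \<and> g \<noteq> h \<and>
                        nilpotent (subgroup_generated G {g, h})} \<rparr>"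

lemma pair_graph_nilpotent_graph:
  assumes "finite (carrier G)"
  shows "pair_graph (nilpotent_graph G)"
proof -
  have "parcs (nilpotent_graph G) \<subseteq> carrier G \<times> carrier G"
    by (auto simp: nilpotent_graph_def)
  then have "finite (parcs (nilpotent_graph G))"
    using assms by (meson finite_SigmaI finite_subset)
  then show ?thesis
    using assms by unfold_locales
      (auto simp: nilpotent_graph_def symmetric_def sym_def insert_commute)
qed

text \<open>
  In a symmetric digraph the strongly connected components \<^const>\<open>pre_digraph.sccs\<close>
  are the connected components of the undirected graph.
\<close>

definition nilpotent_components :: "('a, 'b) monoid_scheme \<Rightarrow> 'a set set" where
  "nilpotent_components G = verts ` pre_digraph.sccs (with_proj (nilpotent_graph G))"


section \<open>Sylow subgroups\<close>

definition sylow_subgroup :: "('a, 'b) monoid_scheme \<Rightarrow> nat \<Rightarrow> 'a set \<Rightarrow> bool" where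
  "sylow_subgroup G p P \<longleftrightarrow> subgroup P G \<and> card P = p ^ multiplicity p (order G)"

end

theory Submission
  imports Defs "HOL-Algebra.Multiplicative_Group"
begin

text \<open>
  Both parts count fixed points of a \<open>p\<close>-group acting by conjugation on \<open>C\<close> enlarged by the
  hypercenter: the number of points and the number of fixed points agree modulo \<open>p\<close>
  (\<open>prime_dvd_card_iff_dvd_card_centralized\<close>). Let \<open>Z\<close> be the hypercenter.

  For the first part take \<open>z \<noteq> 1\<close> in the Sylow subgroup. If \<open>z\<close> lies in \<open>Z\<close>, then \<open>p\<close> divides
  the order of \<open>Z\<close>, and \<open>C \<union> Z\<close> is a union of cosets of \<open>Z\<close>
  (\<open>card_nil_dvd_card_component_Un_nil\<close>). Otherwise \<open>z\<close> lies in \<open>C\<close>, and the powers of \<open>z\<close> act on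
  \<open>C \<union> Z\<close>. The fixed points are the elements of \<open>C \<union> Z\<close> that commute with \<open>z\<close>; but every
  element of the group that commutes with \<open>z\<close> generates an abelian subgroup together with \<open>z\<close>
  and hence already lies in \<open>C \<union> Z\<close>. So the fixed points form the centralizer of \<open>z\<close>, a
  subgroup whose order is divisible by that of \<open>z\<close>.

  For the second part let a subgroup \<open>S\<close> of order \<open>p\<close> of the normalizer of \<open>C\<close> act on \<open>C \<union> {1}\<close>. The
  number of points is \<open>|C| + 1\<close>, and \<open>1\<close> is fixed, so some \<open>c\<close> in \<open>C\<close> is fixed too. As \<open>c\<close> commutes
  with \<open>S\<close>, the nontrivial elements of \<open>S\<close> lie in \<open>C\<close>. A Sylow subgroup containing \<open>S\<close> is
  nilpotent, so all its nontrivial elements are adjacent to one of these.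

  These arguments use that the vertices are the elements outside the hypercenter, that is,
  \<open>nil G = Z\<close> (\<open>nil_eq_hypercenter\<close>). The inclusion of \<open>Z\<close> in \<open>nil G\<close> holds because a group
  generated by a hypercentral element and one further element is cyclic modulo a term of its
  upper central series. Conversely, an element of \<open>nil G\<close> commutes with all elements of coprime
  order, since elements of coprime order commute in a finite nilpotent group. So if its order is a
  power of \<open>p\<close>, it lies in a Sylow \<open>p\<close>-subgroup and centralizes all \<open>p'\<close>-elements. Modulo those,
  the group is a \<open>p\<close>-group, which pushes such an element into the upper central series
  (\<open>sylow_Int_p'_centralizer_subset_hypercenter\<close>). An element of \<open>nil G\<close> outside \<open>Z\<close> of smallest
  order has prime power order, which settles the general case.
\<close>

section \<open>Commutators modulo a normal subgroup\<close>

lemma (in group) commute_inv: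
  assumes x: "x \<in> carrier G" and y: "y \<in> carrier G" and e: "x \<otimes> y = y \<otimes> x"
  shows "x \<otimes> inv y = inv y \<otimes> x"
proof -
  have "x \<otimes> inv y = inv y \<otimes> (y \<otimes> x) \<otimes> inv y"
    using x y by (simp add: inv_solve_left' m_assoc[symmetric])
  also have "\<dots> = inv y \<otimes> x"
    using x y by (simp add: e[symmetric] m_assoc)
  finally show ?thesis .
qed

lemma (in group) commute_mult:
  assumes x: "x \<in> carrier G" and y: "y \<in> carrier G" and z: "z \<in> carrier G"
    and e: "x \<otimes> y = y \<otimes> x" and f: "x \<otimes> z = z \<otimes> x"
  shows "x \<otimes> (y \<otimes> z) = (y \<otimes> z) \<otimes> x"
  using x y z e f by (metis m_assoc)

text \<open>
  The preimage of the centralizer of \<open>H #> x\<close> in the factor group. It reduces statements about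
  commutators with all elements to commutators with generators.
\<close>

lemma (in normal) centralizer_mod_subgroup:
  assumes x: "x \<in> carrier G"
  shows "subgroup {y \<in> carrier G. x \<otimes> y \<otimes> inv x \<otimes> inv y \<in> H} G" (is "subgroup ?K G")
proof -
  interpret r: group_hom G "G Mod H" "\<lambda>x. H #> x"
    using r_coset_hom_Mod factorgroup_is_group
    by (simp add: group_hom_def group_hom_axioms_def is_group)
  have X: "H #> x \<in> carrier (G Mod H)" using x by (rule r.hom_closed)
  have mem: "y \<in> ?K \<longleftrightarrow> y \<in> carrier G \<and>
      (H #> x) \<otimes>\<^bsub>G Mod H\<^esub> (H #> y) = (H #> y) \<otimes>\<^bsub>G Mod H\<^esub> (H #> x)" for y
    using x commutator_mem_iff by blast
  show ?thesis
  proof (rule subgroupI)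
    have "\<one> \<in> ?K"
      unfolding mem using r.hom_one one_closed X r.H.l_one r.H.r_one by presburger
    then show "?K \<noteq> {}" by blast
  next
    fix y assume "y \<in> ?K"
    then have y: "y \<in> carrier G"
      and e: "(H #> x) \<otimes>\<^bsub>G Mod H\<^esub> (H #> y) = (H #> y) \<otimes>\<^bsub>G Mod H\<^esub> (H #> x)"
      unfolding mem by auto
    have Y: "H #> y \<in> carrier (G Mod H)" using y by (rule r.hom_closed)
    have Y': "H #> inv y = inv\<^bsub>G Mod H\<^esub> (H #> y)" using y by (rule r.hom_inv)
    have "(H #> x) \<otimes>\<^bsub>G Mod H\<^esub> inv\<^bsub>G Mod H\<^esub> (H #> y) =
        inv\<^bsub>G Mod H\<^esub> (H #> y) \<otimes>\<^bsub>G Mod H\<^esub> (H #> x)"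
      using r.H.commute_inv[OF X Y e] by simp
    then show "inv y \<in> ?K"
      unfolding mem Y' using y by simp
  next
    fix y z assume "y \<in> ?K" and "z \<in> ?K"
    then have y: "y \<in> carrier G" and z: "z \<in> carrier G"
      and e: "(H #> x) \<otimes>\<^bsub>G Mod H\<^esub> (H #> y) = (H #> y) \<otimes>\<^bsub>G Mod H\<^esub> (H #> x)"
      and f: "(H #> x) \<otimes>\<^bsub>G Mod H\<^esub> (H #> z) = (H #> z) \<otimes>\<^bsub>G Mod H\<^esub> (H #> x)"
      unfolding mem by auto
    have YZ: "H #> (y \<otimes> z) = (H #> y) \<otimes>\<^bsub>G Mod H\<^esub> (H #> z)" using y z by (rule r.hom_mult)
    have "(H #> x) \<otimes>\<^bsub>G Mod H\<^esub> ((H #> y) \<otimes>\<^bsub>G Mod H\<^esub> (H #> z)) =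
        ((H #> y) \<otimes>\<^bsub>G Mod H\<^esub> (H #> z)) \<otimes>\<^bsub>G Mod H\<^esub> (H #> x)"
      using r.H.commute_mult[OF X r.hom_closed[OF y] r.hom_closed[OF z] e f] by simp
    then show "y \<otimes> z \<in> ?K"
      unfolding mem YZ using y z by simp
  qed auto
qed

lemma (in normal) commutator_mem_commute:
  assumes "x \<in> carrier G" "y \<in> carrier G"
  shows "x \<otimes> y \<otimes> inv x \<otimes> inv y \<in> H \<longleftrightarrow> y \<otimes> x \<otimes> inv y \<otimes> inv x \<in> H"
  using assms commutator_mem_iff by metis

lemma (in normal) commutator_mem_of_mem:
  assumes "x \<in> H" "y \<in> carrier G"
  shows "x \<otimes> y \<otimes> inv x \<otimes> inv y \<in> H"
proof -
  have "x \<otimes> (y \<otimes> inv x \<otimes> inv y) \<in> H"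
    using assms inv_op_closed2[of y "inv x"] by (simp add: m_closed)
  then show ?thesis using assms subset by (simp add: m_assoc subsetD)
qed

section \<open>The upper central series\<close>

lemma (in group) upper_central_series_subset: "upper_central_series G n \<subseteq> carrier G"
  using upper_central_series_normal normal_imp_subgroup subgroup.subset by blast

lemma (in group) upper_central_series_mono:
  "m \<le> n \<Longrightarrow> upper_central_series G m \<subseteq> upper_central_series G n"
proof (rule lift_Suc_mono_le)
  show "upper_central_series G k \<subseteq> upper_central_series G (Suc k)" for k
    using normal.commutator_mem_of_mem[OF upper_central_series_normal[of k]]
      upper_central_series_subset[of k] by auto
qed

text \<open>
  The series is increasing and so becomes stationary in a finite group.
\<close>

lemma (in group) hypercenter_eq_upper_central_series:
  assumes "finite (carrier G)"
  obtains n where "hypercenter G = upper_central_series G n"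
proof -
  have "finite (hypercenter G)"
    using assms upper_central_series_subset finite_subset unfolding hypercenter_def
    by (metis (no_types, lifting) UN_least)
  moreover have "\<forall>x \<in> hypercenter G. \<exists>n. x \<in> upper_central_series G n"
    by (auto simp: hypercenter_def)
  then obtain f where f: "\<And>x. x \<in> hypercenter G \<Longrightarrow> x \<in> upper_central_series G (f x)"
    by metis
  ultimately have "f x \<le> Max (f ` hypercenter G)" if "x \<in> hypercenter G" for x
    using that by simp
  then have "hypercenter G \<subseteq> upper_central_series G (Max (f ` hypercenter G))"
    using f upper_central_series_mono by blast
  then have "hypercenter G = upper_central_series G (Max (f ` hypercenter G))"
    by (auto simp: hypercenter_def)
  then show ?thesis by (rule that)
qed

lemma (in group) hypercenter_normal:
  assumes "finite (carrier G)"
  shows "hypercenter G \<lhd> G"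
  using assms upper_central_series_normal by (metis hypercenter_eq_upper_central_series)

lemma (in group) upper_central_series_Int_subgroup:
  assumes H: "subgroup H G"
  shows "upper_central_series G n \<inter> H \<subseteq> upper_central_series (G\<lparr>carrier := H\<rparr>) n"
proof (induction n)
  case (Suc n)
  show ?case
  proof
    fix x assume x: "x \<in> upper_central_series G (Suc n) \<inter> H"
    have "x \<otimes> y \<otimes> inv x \<otimes> inv y \<in> upper_central_series (G\<lparr>carrier := H\<rparr>) n" if y: "y \<in> H" for y
    proof -
      have "x \<otimes> y \<otimes> inv x \<otimes> inv y \<in> H"
        using x y H by (simp add: subgroup.m_closed subgroup.m_inv_closed)
      moreover have "x \<otimes> y \<otimes> inv x \<otimes> inv y \<in> upper_central_series G n"
        using x y subgroup.mem_carrier[OF H] by simp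
      ultimately show ?thesis using Suc by blast
    qed
    then show "x \<in> upper_central_series (G\<lparr>carrier := H\<rparr>) (Suc n)"
      using x H by simp
  qed
qed auto

lemma (in group) nilpotent_subgroup:
  assumes "nilpotent G" "subgroup H G"
  shows "nilpotent (G\<lparr>carrier := H\<rparr>)"
proof -
  interpret K: group "G\<lparr>carrier := H\<rparr>" using assms(2) by (rule subgroup_imp_group)
  obtain n where "upper_central_series G n = carrier G"
    using assms(1) by (auto simp: nilpotent_def)
  then have "H \<subseteq> upper_central_series (G\<lparr>carrier := H\<rparr>) n"
    using upper_central_series_Int_subgroup[OF assms(2), of n] subgroup.subset[OF assms(2)] by auto
  then have "upper_central_series (G\<lparr>carrier := H\<rparr>) n = carrier (G\<lparr>carrier := H\<rparr>)"
    using K.upper_central_series_subset[of n] by auto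
  then show ?thesis unfolding nilpotent_def by blast
qed

lemma (in group) nilpotent_subgroup_of_subgroup:
  assumes "nilpotent (G\<lparr>carrier := K\<rparr>)" "subgroup H G" "subgroup K G" "H \<subseteq> K"
  shows "nilpotent (G\<lparr>carrier := H\<rparr>)"
proof -
  interpret K: group "G\<lparr>carrier := K\<rparr>" using assms(3) by (rule subgroup_imp_group)
  show ?thesis
    using K.nilpotent_subgroup[OF assms(1) subgroup_incl[OF assms(2,3,4)]] by simp
qed

lemma (in group) nilpotent_subgroup_generated_mono:
  assumes "nilpotent (G\<lparr>carrier := K\<rparr>)" "subgroup K G" "S \<subseteq> K"
  shows "nilpotent (subgroup_generated G S)"
  using nilpotent_subgroup_of_subgroup[OF assms(1) subgroup_subgroup_generated assms(2)
      subgroup_generated_minimal[OF assms(2,3)]]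
  by (simp add: subgroup_generated_def)

lemma (in group) nilpotent_subgroup_generated_mono':
  assumes "nilpotent (subgroup_generated G T)" "S \<subseteq> carrier (subgroup_generated G T)"
  shows "nilpotent (subgroup_generated G S)"
  using assms nilpotent_subgroup_generated_mono[OF _ subgroup_subgroup_generated, of T S]
  by (simp add: subgroup_generated_def)

section \<open>Actions of p-groups\<close>

text \<open>
  The maps are restricted to \<open>E\<close> because the elements of \<open>BijGroup E\<close> are extensional functions.
\<close>

lemma group_action_restrictI:
  assumes "group G"
    and closed: "\<And>g x. g \<in> carrier G \<Longrightarrow> x \<in> E \<Longrightarrow> f g x \<in> E"
    and one: "\<And>x. x \<in> E \<Longrightarrow> f \<one>\<^bsub>G\<^esub> x = x"
    and mult: "\<And>g h x. g \<in> carrier G \<Longrightarrow> h \<in> carrier G \<Longrightarrow> x \<in> E \<Longrightarrow> f (g \<otimes>\<^bsub>G\<^esub> h) x = f g (f h x)"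
  shows "group_action G E (\<lambda>g. \<lambda>x \<in> E. f g x)"
proof -
  interpret group G by fact
  have inverse: "f g (f (inv\<^bsub>G\<^esub> g) x) = x" "f (inv\<^bsub>G\<^esub> g) (f g x) = x"
    if "g \<in> carrier G" "x \<in> E" for g x
    using that mult[of g "inv\<^bsub>G\<^esub> g" x] mult[of "inv\<^bsub>G\<^esub> g" g x] one by auto
  have bij: "(\<lambda>x \<in> E. f g x) \<in> carrier (BijGroup E)" if g: "g \<in> carrier G" for g
  proof -
    have "bij_betw (\<lambda>x \<in> E. f g x) E E"
      by (rule bij_betw_byWitness[where f' = "f (inv\<^bsub>G\<^esub> g)"]) (use g inverse closed in auto)
    then show ?thesis by (simp add: BijGroup_def Bij_def)
  qed
  have "(\<lambda>g. \<lambda>x \<in> E. f g x) \<in> hom G (BijGroup E)"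
  proof (rule homI)
    fix g h assume gh: "g \<in> carrier G" "h \<in> carrier G"
    then have "(\<lambda>x \<in> E. f g x) \<in> Bij E" "(\<lambda>x \<in> E. f h x) \<in> Bij E"
      using bij by (simp_all add: BijGroup_def)
    then show "(\<lambda>x \<in> E. f (g \<otimes>\<^bsub>G\<^esub> h) x) = (\<lambda>x \<in> E. f g x) \<otimes>\<^bsub>BijGroup E\<^esub> (\<lambda>x \<in> E. f h x)"
      using gh closed mult by (auto simp: BijGroup_def compose_def)
  qed (rule bij)
  then show ?thesis
    by (simp add: group_action_def group_hom_def group_hom_axioms_def group_BijGroup is_group)
qed

text \<open>
  Orbits have \<open>p\<close>-power length, so the points that are not fixed fall into orbits of length
  divisible by \<open>p\<close>.
\<close>

lemma (in group_action) prime_dvd_card_iff_dvd_card_fixed_points: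
  assumes p: "prime p" and ord: "order G = p ^ k" and E: "finite E"
  shows "p dvd card E \<longleftrightarrow> p dvd card {x \<in> E. \<forall>g \<in> carrier G. \<phi> g x = x}" (is "_ \<longleftrightarrow> p dvd card ?F")
proof -
  let ?O = "{X \<in> orbits G E \<phi>. card X \<noteq> 1}"
  have fin: "finite X" if "X \<in> orbits G E \<phi>" for X
    using that orbits_coverture finite_subset[OF _ E] by blast
  have fixed_iff: "card (Group_Action.orbit G \<phi> x) = 1 \<longleftrightarrow> x \<in> ?F" if x: "x \<in> E" for x
  proof
    assume "card (Group_Action.orbit G \<phi> x) = 1"
    then have "Group_Action.orbit G \<phi> x = {x}"
      using orbit_refl[OF x] by (auto simp: card_1_singleton_iff)
    then show "x \<in> ?F" using x by (auto simp: Group_Action.orbit_def)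
  next
    assume "x \<in> ?F"
    then have "Group_Action.orbit G \<phi> x \<subseteq> {x}" by (auto simp: Group_Action.orbit_def)
    then have "Group_Action.orbit G \<phi> x = {x}" using orbit_refl[OF x] by blast
    then show "card (Group_Action.orbit G \<phi> x) = 1" by simp
  qed
  have "E - ?F = \<Union>?O"
  proof safe
    fix x assume x: "x \<in> E" "x \<notin> \<Union>?O"
    then have "card (Group_Action.orbit G \<phi> x) = 1"
      using orbit_refl[OF x(1)] by (auto simp: orbits_def)
    then show "g \<in> carrier G \<Longrightarrow> \<phi> g x = x" for g using fixed_iff x by blast
  next
    fix x X assume X: "x \<in> X" "X \<in> orbits G E \<phi>" "card X \<noteq> 1"
    then show xE: "x \<in> E" using orbits_coverture by blast
    assume "\<forall>g\<in>carrier G. \<phi> g x = x"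
    then have "card (Group_Action.orbit G \<phi> x) = 1" using xE fixed_iff by blast
    moreover have "X = Group_Action.orbit G \<phi> x"
      using disjoint_union[of X "Group_Action.orbit G \<phi> x"] X xE orbit_refl[OF xE] by (auto simp: orbits_def)
    ultimately show False using X by simp
  qed
  moreover have "p dvd card (\<Union>?O)"
  proof (rule dvd_partition)
    show "finite (\<Union>?O)" using E orbits_coverture by (rule_tac finite_subset[of _ E]) auto
    show "\<forall>X\<in>?O. \<forall>Y\<in>?O. X \<noteq> Y \<longrightarrow> X \<inter> Y = {}" using disjoint_union by blast
    show "\<forall>X\<in>?O. p dvd card X"
    proof
      fix X assume X: "X \<in> ?O"
      then obtain x where "x \<in> E" "X = Group_Action.orbit G \<phi> x" by (auto simp: orbits_def)
      then have "card X dvd p ^ k"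
        using orbit_stabilizer_theorem[of x] ord by (metis dvd_triv_left)
      then obtain j where "card X = p ^ j"
        using p divides_primepow_nat by blast
      then show "p dvd card X" using X by (cases j) auto
    qed
  qed
  moreover have "card E = card (E - ?F) + card ?F"
    using E by (simp add: card_Diff_subset card_mono)
  ultimately show ?thesis by (simp add: dvd_add_right_iff)
qed


lemma (in group) prime_dvd_card_iff_dvd_card_centralized:
  assumes p: "prime p" and S: "subgroup S G" "card S = p ^ k"
    and E: "finite E" "E \<subseteq> carrier G"
    and closed: "\<And>s x. s \<in> S \<Longrightarrow> x \<in> E \<Longrightarrow> s \<otimes> x \<otimes> inv s \<in> E"
  shows "p dvd card E \<longleftrightarrow> p dvd card {x \<in> E. \<forall>s \<in> S. x \<otimes> s = s \<otimes> x}"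
proof -
  interpret S: subgroup S G by (rule S(1))
  interpret act: group_action "G\<lparr>carrier := S\<rparr>" E "\<lambda>s. \<lambda>x \<in> E. s \<otimes> x \<otimes> inv s"
  proof (rule group_action_restrictI)
    show "group (G\<lparr>carrier := S\<rparr>)" using S(1) by (rule subgroup_imp_group)
  next
    fix s t x assume "s \<in> carrier (G\<lparr>carrier := S\<rparr>)" "t \<in> carrier (G\<lparr>carrier := S\<rparr>)" "x \<in> E"
    then have "s \<in> carrier G" "t \<in> carrier G" "x \<in> carrier G" using E(2) by auto
    then show "s \<otimes>\<^bsub>G\<lparr>carrier := S\<rparr>\<^esub> t \<otimes> x \<otimes> inv (s \<otimes>\<^bsub>G\<lparr>carrier := S\<rparr>\<^esub> t)
        = s \<otimes> (t \<otimes> x \<otimes> inv t) \<otimes> inv s"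
      by (simp add: m_assoc inv_mult_group)
  next
    fix x assume "x \<in> E"
    then have "x \<in> carrier G" using E(2) by blast
    then show "\<one>\<^bsub>G\<lparr>carrier := S\<rparr>\<^esub> \<otimes> x \<otimes> inv \<one>\<^bsub>G\<lparr>carrier := S\<rparr>\<^esub> = x" by simp
  qed (use closed in simp)
  have "s \<otimes> x \<otimes> inv s = x \<longleftrightarrow> x \<otimes> s = s \<otimes> x" if "s \<in> S" "x \<in> E" for s x
  proof -
    have "s \<in> carrier G" "x \<in> carrier G" using that E(2) by auto
    then show ?thesis using inv_solve_right'[of x "s \<otimes> x" s] by auto
  qed
  then have "{x \<in> E. \<forall>s \<in> carrier (G\<lparr>carrier := S\<rparr>). (\<lambda>x \<in> E. s \<otimes> x \<otimes> inv s) x = x}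
      = {x \<in> E. \<forall>s \<in> S. x \<otimes> s = s \<otimes> x}"
    by auto
  then show ?thesis
    using act.prime_dvd_card_iff_dvd_card_fixed_points[OF p _ E(1)] S(2) by (simp add: order_def)
qed

section \<open>Nilpotency of p-groups\<close>

lemma (in group) center_p_group_nontrivial:
  assumes p: "prime p" and ord: "order G = p ^ k" and k: "k > 0"
  obtains z where "z \<in> carrier G" "z \<noteq> \<one>" "\<And>y. y \<in> carrier G \<Longrightarrow> z \<otimes> y = y \<otimes> z"
proof -
  have fin: "finite (carrier G)"
    using ord p by (metis order_gt_0_iff_finite prime_gt_0_nat zero_less_power)
  let ?F = "{x \<in> carrier G. \<forall>s \<in> carrier G. x \<otimes> s = s \<otimes> x}"
  have "p dvd card (carrier G)"
    using ord k by (simp add: order_def)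
  then have "p dvd card ?F"
    using prime_dvd_card_iff_dvd_card_centralized[OF p subgroup_self _ fin] ord
    by (simp add: order_def)
  moreover have "\<one> \<in> ?F" by simp
  ultimately have "?F \<noteq> {\<one>}"
    using p by (metis card_1_singleton_iff One_nat_def not_prime_unit)
  then obtain z where "z \<in> ?F" "z \<noteq> \<one>" using \<open>\<one> \<in> ?F\<close> by blast
  then show ?thesis using that by blast
qed

text \<open>
  The factor group is a nontrivial \<open>p\<close>-group and has a nontrivial center, whose preimage is the
  next term.
\<close>

lemma (in group) upper_central_series_p_group_strict:
  assumes p: "prime p" and ord: "order G = p ^ k"
    and proper: "upper_central_series G n \<noteq> carrier G"
  shows "upper_central_series G n \<subset> upper_central_series G (Suc n)"
proof -
  let ?N = "upper_central_series G n"
  have fin: "finite (carrier G)"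
    using ord p by (metis order_gt_0_iff_finite prime_gt_0_nat zero_less_power)
  interpret N: normal ?N G by (rule upper_central_series_normal)
  interpret Q: group "G Mod ?N" by (rule N.factorgroup_is_group)
  have lag: "order (G Mod ?N) * card ?N = p ^ k"
    using lagrange[OF N.is_subgroup] ord by (simp add: order_def FactGroup_def)
  then have "order (G Mod ?N) dvd p ^ k" by (metis dvd_triv_left)
  then obtain j where j: "order (G Mod ?N) = p ^ j"
    using p divides_primepow_nat by blast
  have "j \<noteq> 0"
  proof
    assume "j = 0"
    then have "card ?N = card (carrier G)" using lag j ord by (simp add: order_def)
    then show False using proper fin N.subset by (simp add: card_subset_eq)
  qed
  then obtain Z where Z: "Z \<in> carrier (G Mod ?N)" "Z \<noteq> \<one>\<^bsub>G Mod ?N\<^esub>"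
    and cent: "\<And>Y. Y \<in> carrier (G Mod ?N) \<Longrightarrow> Z \<otimes>\<^bsub>G Mod ?N\<^esub> Y = Y \<otimes>\<^bsub>G Mod ?N\<^esub> Z"
    using Q.center_p_group_nontrivial[OF p j] by blast
  from Z(1) obtain x where x: "x \<in> carrier G" "Z = ?N #> x"
    by (auto simp: carrier_FactGroup)
  have "x \<notin> ?N"
    using x Z(2) coset_join2[OF x(1) N.is_subgroup] by auto
  moreover have "x \<in> upper_central_series G (Suc n)"
    unfolding upper_central_series_Suc_center_Mod using x cent by blast
  moreover have "?N \<subseteq> upper_central_series G (Suc n)"
    by (rule upper_central_series_mono) simp
  ultimately show ?thesis by blast
qed

lemma (in group) p_group_nilpotent:
  assumes p: "prime p" and ord: "order G = p ^ k"
  shows "nilpotent G"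
proof -
  have fin: "finite (carrier G)"
    using ord p by (metis order_gt_0_iff_finite prime_gt_0_nat zero_less_power)
  have "upper_central_series G n = carrier G \<or> n < card (upper_central_series G n)" for n
  proof (induction n)
    case (Suc n)
    show ?case
    proof (cases "upper_central_series G n = carrier G")
      case True
      then show ?thesis
        using upper_central_series_mono[of n "Suc n"] upper_central_series_subset[of "Suc n"] by auto
    next
      case False
      then have "card (upper_central_series G n) < card (upper_central_series G (Suc n))"
        using upper_central_series_p_group_strict[OF p ord] upper_central_series_subset fin
        by (meson finite_subset psubset_card_mono)
      then show ?thesis using False Suc by linarith
    qed
  qed simp
  moreover have "card (upper_central_series G (order G)) \<le> order G"
    unfolding order_def using upper_central_series_subset fin by (rule_tac card_mono) auto
  ultimately have "upper_central_series G (order G) = carrier G"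
    by (metis linorder_not_less)
  then show ?thesis unfolding nilpotent_def by blast
qed

section \<open>Sylow subgroups and elements of coprime order\<close>

lemma (in group) card_subgroup_dvd:
  assumes "subgroup H G" "subgroup K G" "H \<subseteq> K"
  shows "card H dvd card K"
proof -
  interpret K: group "G\<lparr>carrier := K\<rparr>" using assms(2) by (rule subgroup_imp_group)
  show ?thesis
    using K.lagrange[OF subgroup_incl[OF assms]] by (simp add: order_def) (metis dvd_triv_right)
qed

lemma (in group) ord_dvd_card_subgroup:
  assumes "subgroup H G" "x \<in> H"
  shows "ord x dvd card H"
proof -
  have "x \<in> carrier G" using assms subgroup.mem_carrier by metis
  moreover have "generate G {x} \<subseteq> H"
    using assms by (intro generate_subgroup_incl) auto
  ultimately show ?thesis
    using card_subgroup_dvd[OF generate_is_subgroup assms(1), of "{x}"] generate_pow_card by simp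
qed

lemma (in group) sylow_subgroup_exists:
  assumes "finite (carrier G)" "prime p"
  obtains P where "sylow_subgroup G p P"
proof -
  have "p ^ multiplicity p (order G) dvd order G" by (rule multiplicity_dvd)
  then obtain m where "order G = p ^ multiplicity p (order G) * m" by (elim dvdE)
  then show ?thesis
    using sylow_thm[OF assms(2) is_group _ assms(1)] that by (auto simp: sylow_subgroup_def)
qed

text \<open>
  \<open>Q\<close> acts on the right cosets of a Sylow subgroup \<open>P\<close> by right multiplication with inverses. The
  number of cosets is prime to \<open>p\<close>, so some coset \<open>P #> g\<close> is fixed; this means that the conjugate
  of \<open>P\<close> by \<open>g\<close> contains \<open>Q\<close>.
\<close>

lemma (in group) sylow_subgroup_containing_p_subgroup:
  assumes fin: "finite (carrier G)" and p: "prime p"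
    and Q: "subgroup Q G" "card Q = p ^ k"
  obtains P where "sylow_subgroup G p P" "Q \<subseteq> P"
proof -
  obtain P where P: "sylow_subgroup G p P"
    using sylow_subgroup_exists fin p by blast
  then have sub: "subgroup P G" and card: "card P = p ^ multiplicity p (order G)"
    by (auto simp: sylow_subgroup_def)
  interpret P: subgroup P G by (rule sub)
  interpret Q: subgroup Q G by (rule Q(1))
  interpret QG: group "G\<lparr>carrier := Q\<rparr>" using Q(1) by (rule subgroup_imp_group)
  have ord: "order (G\<lparr>carrier := Q\<rparr>) = p ^ k" using Q(2) by (simp add: order_def)
  interpret act: group_action "G\<lparr>carrier := Q\<rparr>" "rcosets P" "\<lambda>q. \<lambda>R \<in> rcosets P. R #> inv q"
  proof (rule group_action_restrictI)
    fix q R assume "q \<in> carrier (G\<lparr>carrier := Q\<rparr>)" "R \<in> rcosets P"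
    then show "R #> inv q \<in> rcosets P"
      using Q.mem_carrier P.subset by (auto simp: RCOSETS_def coset_mult_assoc)
  next
    fix R assume "R \<in> rcosets P"
    then show "R #> inv \<one>\<^bsub>G\<lparr>carrier := Q\<rparr>\<^esub> = R"
      using P.rcosets_carrier[OF is_group] coset_mult_one by simp
  next
    fix q r R
    assume "q \<in> carrier (G\<lparr>carrier := Q\<rparr>)" "r \<in> carrier (G\<lparr>carrier := Q\<rparr>)" "R \<in> rcosets P"
    then show "R #> inv (q \<otimes>\<^bsub>G\<lparr>carrier := Q\<rparr>\<^esub> r) = R #> inv r #> inv q"
      using P.rcosets_carrier[OF is_group] by (simp add: inv_mult_group coset_mult_assoc)
  qed (rule QG.is_group)
  let ?F = "{R \<in> rcosets P. \<forall>q \<in> carrier (G\<lparr>carrier := Q\<rparr>). (\<lambda>R \<in> rcosets P. R #> inv q) R = R}"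
  have "\<not> p dvd card (rcosets P)"
  proof
    assume "p dvd card (rcosets P)"
    then have "p * p ^ multiplicity p (order G) dvd order G"
      using lagrange[OF sub] card by (metis dvd_refl mult_dvd_mono)
    then have "p ^ Suc (multiplicity p (order G)) dvd order G" by simp
    moreover have "order G \<noteq> 0" using fin order_gt_0_iff_finite by simp
    ultimately show False
      using p by (metis Suc_n_not_le_n not_prime_unit power_dvd_iff_le_multiplicity)
  qed
  moreover have "finite (rcosets P)"
    using fin rcosets_part_G[OF sub] by (simp add: finite_UnionD)
  ultimately have "\<not> p dvd card ?F"
    using act.prime_dvd_card_iff_dvd_card_fixed_points[OF p ord] by blast
  then have "?F \<noteq> {}" by (metis card.empty dvd_0_right)
  then obtain R where R: "R \<in> ?F" by blast
  then obtain g where g: "g \<in> carrier G" "R = P #> g" by (auto simp: RCOSETS_def)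
  have conj: "g \<otimes> q \<otimes> inv g \<in> P" if q: "q \<in> Q" for q
  proof -
    have "\<forall>r \<in> Q. P #> g #> inv r = P #> g" using R g by auto
    then have "P #> g #> inv (inv q) = P #> g" using q Q.m_inv_closed by blast
    then have "P #> (g \<otimes> q) = P #> g" using g q P.subset by (simp add: coset_mult_assoc)
    then have "g \<otimes> q \<in> P #> g" using g q rcos_self[OF _ sub] by (metis Q.mem_carrier m_closed)
    then obtain h where "h \<in> P" "g \<otimes> q = h \<otimes> g" by (auto simp: r_coset_def)
    then show ?thesis using g q by (simp add: m_assoc)
  qed
  let ?P = "(\<lambda>x. inv g \<otimes> x \<otimes> g) ` P"
  have "?P = inv g <# P #> g" by (auto simp: l_coset_def r_coset_def)
  then have "subgroup ?P G" using subgroup_conjugation_is_surj1[OF g(1) sub] by simp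
  moreover have "inj_on (\<lambda>x. inv g \<otimes> x \<otimes> g) P"
    using g by (auto intro!: inj_onI)
  then have "card ?P = card P" by (rule card_image)
  moreover have "Q \<subseteq> ?P"
  proof
    fix q assume q: "q \<in> Q"
    then have "q = inv g \<otimes> (g \<otimes> q \<otimes> inv g) \<otimes> g"
      using g by (simp add: m_assoc inv_solve_left)
    then show "q \<in> ?P" using conj[OF q] by blast
  qed
  ultimately show ?thesis using card that by (simp add: sylow_subgroup_def)
qed


lemma (in group) pow_commutator_central:
  assumes c: "c \<in> carrier G" and x: "x \<in> carrier G" and y: "y \<in> carrier G"
    and cent: "\<And>z. z \<in> carrier G \<Longrightarrow> c \<otimes> z = z \<otimes> c"
    and xy: "x \<otimes> y = c \<otimes> (y \<otimes> x)"
  shows "x [^] (n::nat) \<otimes> y = c [^] n \<otimes> (y \<otimes> x [^] n)"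
proof (induction n)
  case (Suc n)
  have cx: "x [^] n \<otimes> c = c \<otimes> x [^] n" using cent[of "x [^] n"] x by simp
  have "x [^] Suc n \<otimes> y = x [^] n \<otimes> (c \<otimes> (y \<otimes> x))"
    using x y c by (simp add: m_assoc xy)
  also have "\<dots> = c \<otimes> (x [^] n \<otimes> y) \<otimes> x"
    using x y c by (simp add: m_assoc[symmetric] cx)
  also have "\<dots> = c \<otimes> (c [^] n \<otimes> (y \<otimes> x [^] n)) \<otimes> x"
    by (simp only: Suc)
  also have "\<dots> = (c \<otimes> c [^] n) \<otimes> (y \<otimes> (x [^] n \<otimes> x))"
    using x y c by (simp add: m_assoc)
  also have "\<dots> = c [^] Suc n \<otimes> (y \<otimes> x [^] Suc n)"
    using c cent[of "c [^] n"] by simp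
  finally show ?case .
qed (use x y in auto)

text \<open>
  Raising \<open>x\<close> to the power \<open>a\<close> gives \<open>c\<^sup>a = 1\<close>, and exchanging the roles of \<open>x\<close> and \<open>y\<close>, which
  inverts \<open>c\<close>, gives \<open>c\<^sup>b = 1\<close>.
\<close>

lemma (in group) central_commutator_coprime_eq_one:
  assumes c: "c \<in> carrier G" and x: "x \<in> carrier G" and y: "y \<in> carrier G"
    and cent: "\<And>z. z \<in> carrier G \<Longrightarrow> c \<otimes> z = z \<otimes> c"
    and xy: "x \<otimes> y = c \<otimes> (y \<otimes> x)"
    and a: "x [^] (a::nat) = \<one>" and b: "y [^] (b::nat) = \<one>" and ab: "coprime a b"
  shows "c = \<one>"
proof -
  have "y = c [^] a \<otimes> y"
    using pow_commutator_central[OF c x y cent xy, of a] a c y by simp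
  then have ca: "c [^] a = \<one>" using c y by (metis nat_pow_closed r_cancel_one')
  have "y \<otimes> x = inv c \<otimes> (x \<otimes> y)"
    using c x y by (simp add: xy m_assoc[symmetric])
  moreover have "inv c \<otimes> z = z \<otimes> inv c" if "z \<in> carrier G" for z
    using commute_inv[OF that c] cent[OF that] by simp
  ultimately have "y [^] b \<otimes> x = inv c [^] b \<otimes> (x \<otimes> y [^] b)"
    using c x y by (intro pow_commutator_central) simp_all
  then have "x = inv (c [^] b) \<otimes> x"
    using b c x by (simp add: nat_pow_inv)
  then have "inv (c [^] b) = \<one>" using c x by (metis inv_closed nat_pow_closed r_cancel_one')
  then have "c [^] b = \<one>" using c by (metis inv_inv inv_one nat_pow_closed)
  with ca have "ord c dvd a" "ord c dvd b" using c by (simp_all add: pow_eq_id)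
  then have "ord c = 1" using ab by (metis coprime_common_divisor_nat)
  then show ?thesis using c ord_eq_1 by blast
qed

text \<open>
  The commutator of \<open>x\<close> and \<open>y\<close> descends through the upper central series: if it lies in the term
  of index \<open>n + 1\<close>, it is central modulo the term of index \<open>n\<close>, hence trivial there.
\<close>

lemma (in group) nilpotent_coprime_commute:
  assumes nil: "nilpotent G" and x: "x \<in> carrier G" and y: "y \<in> carrier G"
    and a: "x [^] (a::nat) = \<one>" and b: "y [^] (b::nat) = \<one>" and ab: "coprime a b"
  shows "x \<otimes> y = y \<otimes> x"
proof -
  define c where "c = x \<otimes> y \<otimes> inv x \<otimes> inv y"
  have c: "c \<in> carrier G" using x y by (simp add: c_def)
  have "c = (x \<otimes> y) \<otimes> inv (y \<otimes> x)" using x y by (simp add: c_def inv_mult_group m_assoc)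
  then have xy: "x \<otimes> y = c \<otimes> (y \<otimes> x)" using x y c inv_solve_right by simp
  have "c \<in> upper_central_series G n \<Longrightarrow> c = \<one>" for n
  proof (induction n)
    case (Suc n)
    let ?N = "upper_central_series G n"
    interpret N: normal ?N G by (rule upper_central_series_normal)
    interpret r: group_hom G "G Mod ?N" "\<lambda>x. ?N #> x"
      using N.r_coset_hom_Mod N.factorgroup_is_group
      by (simp add: group_hom_def group_hom_axioms_def is_group)
    have "?N #> c = \<one>\<^bsub>G Mod ?N\<^esub>"
    proof (rule r.H.central_commutator_coprime_eq_one)
      show "?N #> c \<in> carrier (G Mod ?N)" using c by (rule r.hom_closed)
      show "?N #> x \<in> carrier (G Mod ?N)" using x by (rule r.hom_closed)
      show "?N #> y \<in> carrier (G Mod ?N)" using y by (rule r.hom_closed)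
      show "(?N #> c) \<otimes>\<^bsub>G Mod ?N\<^esub> Y = Y \<otimes>\<^bsub>G Mod ?N\<^esub> (?N #> c)"
        if "Y \<in> carrier (G Mod ?N)" for Y
        using Suc.prems that unfolding upper_central_series_Suc_center_Mod by blast
      have "?N #> (x \<otimes> y) = ?N #> (c \<otimes> (y \<otimes> x))" using xy by simp
      then show "(?N #> x) \<otimes>\<^bsub>G Mod ?N\<^esub> (?N #> y) =
          (?N #> c) \<otimes>\<^bsub>G Mod ?N\<^esub> ((?N #> y) \<otimes>\<^bsub>G Mod ?N\<^esub> (?N #> x))"
        using x y c by (simp only: r.hom_mult m_closed)
      show "(?N #> x) [^]\<^bsub>G Mod ?N\<^esub> a = \<one>\<^bsub>G Mod ?N\<^esub>"
        using r.hom_nat_pow[OF x, of a] a r.hom_one by simp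
      show "(?N #> y) [^]\<^bsub>G Mod ?N\<^esub> b = \<one>\<^bsub>G Mod ?N\<^esub>"
        using r.hom_nat_pow[OF y, of b] b r.hom_one by simp
    qed (rule ab)
    then have "c \<in> ?N" using coset_join1[OF _ c N.is_subgroup] by (simp add: FactGroup_def)
    then show ?case by (rule Suc.IH)
  qed simp
  then have "c = \<one>" using nil c unfolding nilpotent_def by metis
  then show ?thesis using xy x y by simp
qed

section \<open>The hypercenter as the set nil\<close>

text \<open>
  The centralizer of \<open>O\<^sup>p(G)\<close>, the subgroup generated by the elements of order prime to \<open>p\<close>.
\<close>

definition (in group) p'_centralizer :: "nat \<Rightarrow> 'a set" where
  "p'_centralizer p =
     {x \<in> carrier G. \<forall>y \<in> carrier G. coprime (ord y) p \<longrightarrow> x \<otimes> y = y \<otimes> x}"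

lemma (in group) ord_conjugate_dvd:
  assumes x: "x \<in> carrier G" and y: "y \<in> carrier G"
  shows "ord (inv x \<otimes> y \<otimes> x) dvd ord y"
proof -
  have "(inv x \<otimes> y \<otimes> x) [^] n = inv x \<otimes> y [^] n \<otimes> x" for n :: nat
  proof (induction n)
    case (Suc n)
    have "(inv x \<otimes> y \<otimes> x) [^] Suc n = (inv x \<otimes> y [^] n \<otimes> x) \<otimes> (inv x \<otimes> y \<otimes> x)"
      by (simp only: nat_pow_Suc Suc)
    also have "\<dots> = inv x \<otimes> y [^] n \<otimes> (x \<otimes> inv x) \<otimes> y \<otimes> x"
      using x y by (simp only: m_assoc inv_closed m_closed nat_pow_closed)
    finally show ?case using x y by (simp add: m_assoc)
  qed (use x in auto)
  then have "(inv x \<otimes> y \<otimes> x) [^] ord y = \<one>" using x y by simp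
  then show ?thesis using x y by (simp add: pow_eq_id)
qed

lemma (in group) p'_centralizer_normal: "p'_centralizer p \<lhd> G"
proof (rule normal_invI)
  show "subgroup (p'_centralizer p) G"
  proof (rule subgroupI)
    have "\<one> \<in> p'_centralizer p" by (simp add: p'_centralizer_def)
    then show "p'_centralizer p \<noteq> {}" by blast
    fix x assume "x \<in> p'_centralizer p"
    then show "inv x \<in> p'_centralizer p"
      using commute_inv[of _ x] by (simp add: p'_centralizer_def)
  next
    fix x y assume "x \<in> p'_centralizer p" "y \<in> p'_centralizer p"
    then show "x \<otimes> y \<in> p'_centralizer p"
      using commute_mult[of _ x y] by (simp add: p'_centralizer_def)
  qed (auto simp: p'_centralizer_def)
next
  fix x y assume x: "x \<in> carrier G" and y: "y \<in> p'_centralizer p"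
  have yG: "y \<in> carrier G" using y by (simp add: p'_centralizer_def)
  have "(x \<otimes> y \<otimes> inv x) \<otimes> z = z \<otimes> (x \<otimes> y \<otimes> inv x)"
    if z: "z \<in> carrier G" "coprime (ord z) p" for z
  proof -
    have "coprime (ord (inv x \<otimes> z \<otimes> x)) p"
      using ord_conjugate_dvd[OF x z(1)] z(2) coprime_divisors[OF _ dvd_refl] by blast
    then have e: "y \<otimes> (inv x \<otimes> z \<otimes> x) = (inv x \<otimes> z \<otimes> x) \<otimes> y"
      using y x z by (simp add: p'_centralizer_def)
    have "(x \<otimes> y \<otimes> inv x) \<otimes> z = x \<otimes> (y \<otimes> (inv x \<otimes> z \<otimes> x)) \<otimes> inv x"
      using x yG z by (simp add: m_assoc)
    also have "\<dots> = z \<otimes> (x \<otimes> y \<otimes> inv x)"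
      unfolding e using x yG z by (simp add: m_assoc[symmetric])
    finally show ?thesis .
  qed
  then show "x \<otimes> y \<otimes> inv x \<in> p'_centralizer p"
    using x yG by (simp add: p'_centralizer_def)
qed

text \<open>
  Such a subgroup contains a Sylow subgroup for every prime, so its order is divisible by that of
  the group.
\<close>

lemma (in group) subgroup_containing_sylow_and_p'_elements:
  assumes fin: "finite (carrier G)" and p: "prime p"
    and P: "sylow_subgroup G p P" and K: "subgroup K G" "P \<subseteq> K"
    and p': "\<And>y. y \<in> carrier G \<Longrightarrow> coprime (ord y) p \<Longrightarrow> y \<in> K"
  shows "K = carrier G"
proof -
  have n0: "order G \<noteq> 0" using fin order_gt_0_iff_finite by simp
  have finK: "finite K" using K(1) fin by (meson finite_subset subgroup.subset)
  then have k0: "card K \<noteq> 0" using subgroup.one_closed[OF K(1)] by auto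
  have "order G dvd card K"
  proof (rule multiplicity_le_imp_dvd[OF n0])
    fix q :: nat assume q: "prime q"
    have "q ^ multiplicity q (order G) dvd card K"
    proof (cases "q = p")
      case True
      then show ?thesis using card_subgroup_dvd[OF _ K] P by (simp add: sylow_subgroup_def)
    next
      case False
      obtain Q where Q: "subgroup Q G" "card Q = q ^ multiplicity q (order G)"
        using sylow_subgroup_exists[OF fin q] by (auto simp: sylow_subgroup_def)
      have "Q \<subseteq> K"
      proof
        fix y assume y: "y \<in> Q"
        have "coprime (q ^ multiplicity q (order G)) p"
          using False p q by (simp add: primes_coprime)
        then have "coprime (ord y) p"
          using coprime_divisors[OF ord_dvd_card_subgroup[OF Q(1) y] dvd_refl] Q(2) by simp
        then show "y \<in> K" using p' subgroup.mem_carrier[OF Q(1) y] by blast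
      qed
      then show ?thesis using card_subgroup_dvd[OF Q(1) K(1)] Q(2) by simp
    qed
    then show "multiplicity q (order G) \<le> multiplicity q (card K)"
      using k0 q by (metis not_prime_unit power_dvd_iff_le_multiplicity)
  qed
  then have "card (carrier G) \<le> card K" using k0 by (simp add: order_def dvd_imp_le)
  then show ?thesis using fin subgroup.subset[OF K(1)] by (simp add: card_seteq)
qed

text \<open>
  The Sylow subgroup \<open>P\<close> is nilpotent, and the terms of its upper central series, intersected with
  the centralizer, lie in those of \<open>G\<close>. Indeed, to see that \<open>x\<close> is central modulo a term of the series
  of \<open>G\<close> it suffices to test commutators with elements of \<open>P\<close> and with \<open>p'\<close>-elements; the latter
  are trivial.
\<close>

lemma (in group) sylow_Int_p'_centralizer_subset_hypercenter:
  assumes fin: "finite (carrier G)" and p: "prime p" and P: "sylow_subgroup G p P"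
  shows "P \<inter> p'_centralizer p \<subseteq> hypercenter G"
proof -
  have sub: "subgroup P G" and card: "card P = p ^ multiplicity p (order G)"
    using P by (auto simp: sylow_subgroup_def)
  interpret P: subgroup P G by (rule sub)
  interpret PG: group "G\<lparr>carrier := P\<rparr>" using sub by (rule subgroup_imp_group)
  interpret X: normal "p'_centralizer p" G by (rule p'_centralizer_normal)
  have "P \<inter> p'_centralizer p \<inter> upper_central_series (G\<lparr>carrier := P\<rparr>) n
      \<subseteq> upper_central_series G n" for n
  proof (induction n)
    case (Suc n)
    interpret Z: normal "upper_central_series G n" G by (rule upper_central_series_normal)
    show ?case
    proof
      fix x assume "x \<in> P \<inter> p'_centralizer p \<inter> upper_central_series (G\<lparr>carrier := P\<rparr>) (Suc n)"
      then have xP: "x \<in> P" and xX: "x \<in> p'_centralizer p"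
        and xZ: "\<And>y. y \<in> P \<Longrightarrow> x \<otimes> y \<otimes> inv x \<otimes> inv y \<in> upper_central_series (G\<lparr>carrier := P\<rparr>) n"
        using sub by auto
      have xG: "x \<in> carrier G" using xP by (rule P.mem_carrier)
      let ?K = "{y \<in> carrier G. x \<otimes> y \<otimes> inv x \<otimes> inv y \<in> upper_central_series G n}"
      have "?K = carrier G"
      proof (rule subgroup_containing_sylow_and_p'_elements[OF fin p P])
        show "subgroup ?K G" using Z.centralizer_mod_subgroup[OF xG] .
        show "P \<subseteq> ?K"
        proof
          fix y assume y: "y \<in> P"
          have "x \<otimes> y \<otimes> inv x \<otimes> inv y \<in> P" using xP y by simp
          moreover have "x \<otimes> y \<otimes> inv x \<otimes> inv y \<in> p'_centralizer p"
            using X.commutator_mem_of_mem[OF xX P.mem_carrier[OF y]] .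
          ultimately show "y \<in> ?K" using Suc xZ[OF y] P.mem_carrier[OF y] by blast
        qed
        fix y assume y: "y \<in> carrier G" "coprime (ord y) p"
        then have "x \<otimes> y = y \<otimes> x" using xX unfolding p'_centralizer_def by blast
        then have "x \<otimes> y \<otimes> inv x \<otimes> inv y = y \<otimes> x \<otimes> inv x \<otimes> inv y" by (simp only:)
        also have "\<dots> = \<one>" using xG y by (simp add: m_assoc)
        finally have "x \<otimes> y \<otimes> inv x \<otimes> inv y = \<one>" .
        then show "y \<in> ?K" using y Z.one_closed by simp
      qed
      then show "x \<in> upper_central_series G (Suc n)" using xG by auto
    qed
  qed auto
  moreover have "nilpotent (G\<lparr>carrier := P\<rparr>)"
    using PG.p_group_nilpotent[OF p] card by (simp add: order_def)
  then obtain n where "upper_central_series (G\<lparr>carrier := P\<rparr>) n = P"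
    by (auto simp: nilpotent_def)
  ultimately have "P \<inter> p'_centralizer p \<subseteq> upper_central_series G n" by blast
  then show ?thesis by (auto simp: hypercenter_def)
qed


lemma (in group) nil_subset_carrier: "nil G \<subseteq> carrier G"
  by (auto simp: nil_def)

lemma (in group) nil_pow_closed:
  assumes g: "g \<in> nil G"
  shows "g [^] (n::nat) \<in> nil G"
proof -
  have gG: "g \<in> carrier G" using g nil_subset_carrier by blast
  have "nilpotent (subgroup_generated G {g [^] n, h})" if h: "h \<in> carrier G" for h
  proof (rule nilpotent_subgroup_generated_mono')
    show "nilpotent (subgroup_generated G {g, h})" using g h by (simp add: nil_def)
    interpret S: group "subgroup_generated G {g, h}" by (rule group_subgroup_generated)
    have "g \<in> carrier (subgroup_generated G {g, h})" "h \<in> carrier (subgroup_generated G {g, h})"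
      using gG h subgroup_generated_subset_carrier_subset[of "{g, h}"] by auto
    then show "{g [^] n, h} \<subseteq> carrier (subgroup_generated G {g, h})"
      using S.nat_pow_closed[of g n] by (simp add: pow_subgroup_generated)
  qed
  then show ?thesis using gG by (simp add: nil_def)
qed

lemma (in group) nil_commute_coprime:
  assumes g: "g \<in> nil G" and h: "h \<in> carrier G" and gh: "coprime (ord g) (ord h)"
  shows "g \<otimes> h = h \<otimes> g"
proof -
  interpret S: group "subgroup_generated G {g, h}" by (rule group_subgroup_generated)
  have gG: "g \<in> carrier G" using g nil_subset_carrier by blast
  have "{g, h} \<subseteq> carrier (subgroup_generated G {g, h})"
    using gG h subgroup_generated_subset_carrier_subset[of "{g, h}"] by auto
  moreover have "nilpotent (subgroup_generated G {g, h})" using g h by (simp add: nil_def)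
  ultimately show ?thesis
    using S.nilpotent_coprime_commute[of g h "ord g" "ord h"] gG h gh
    by (simp add: pow_subgroup_generated)
qed

lemma (in group) nil_prime_power_order_in_hypercenter:
  assumes fin: "finite (carrier G)" and p: "prime p"
    and g: "g \<in> nil G" and ord: "ord g = p ^ k"
  shows "g \<in> hypercenter G"
proof -
  have gG: "g \<in> carrier G" using g nil_subset_carrier by blast
  have "subgroup (generate G {g}) G" "card (generate G {g}) = p ^ k"
    using gG generate_is_subgroup generate_pow_card ord by auto
  then obtain P where P: "sylow_subgroup G p P" "generate G {g} \<subseteq> P"
    using sylow_subgroup_containing_p_subgroup[OF fin p] by metis
  then have "g \<in> P" by (auto intro: generate.incl)
  moreover have "g \<otimes> h = h \<otimes> g" if "h \<in> carrier G" "coprime (ord h) p" for h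
    using nil_commute_coprime[OF g that(1)] that(2) ord by (simp add: coprime_commute)
  then have "g \<in> p'_centralizer p" using gG by (simp add: p'_centralizer_def)
  ultimately show ?thesis
    using sylow_Int_p'_centralizer_subset_hypercenter[OF fin p P(1)] by blast
qed

text \<open>
  The order of \<open>x\<close> modulo \<open>H\<close> divides both exponents.
\<close>

lemma (in normal) mem_of_coprime_pow_mem:
  assumes x: "x \<in> carrier G" and m: "x [^] (m::nat) \<in> H" and n: "x [^] (n::nat) \<in> H"
    and mn: "coprime m n"
  shows "x \<in> H"
proof -
  interpret r: group_hom G "G Mod H" "\<lambda>x. H #> x"
    using r_coset_hom_Mod factorgroup_is_group
    by (simp add: group_hom_def group_hom_axioms_def is_group)
  have X: "H #> x \<in> carrier (G Mod H)" using x by (rule r.hom_closed)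
  have "(H #> x) [^]\<^bsub>G Mod H\<^esub> k = \<one>\<^bsub>G Mod H\<^esub>" if "x [^] k \<in> H" for k :: nat
    using r.hom_nat_pow[OF x, of k] coset_join2[OF _ is_subgroup that] x by (simp add: FactGroup_def)
  then have "r.H.ord (H #> x) dvd m" "r.H.ord (H #> x) dvd n"
    using m n X r.H.pow_eq_id by blast+
  then have "r.H.ord (H #> x) = 1" using mn by (metis coprime_common_divisor_nat)
  then have "H #> x = H" using X r.H.ord_eq_1 by (simp add: FactGroup_def)
  then show ?thesis using coset_join1[OF _ x is_subgroup] by simp
qed

lemma (in group) nil_subset_hypercenter:
  assumes fin: "finite (carrier G)"
  shows "nil G \<subseteq> hypercenter G"
proof
  interpret Z: normal "hypercenter G" G by (rule hypercenter_normal[OF fin])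
  fix g assume "g \<in> nil G"
  \<comment> \<open>Induction on the order: for two different primes dividing it, the corresponding powers of
    \<open>g\<close> have smaller order, so they are hypercentral and \<open>g\<close> is hypercentral with them.\<close>
  then show "g \<in> hypercenter G"
  proof (induction "ord g" arbitrary: g rule: less_induct)
    case less
    have gG: "g \<in> carrier G" using less.prems nil_subset_carrier by blast
    have ord0: "ord g > 0" using ord_ge_1[OF fin gG] by simp
    have prime_pow: "g [^] q \<in> hypercenter G" if q: "prime q" "q dvd ord g" for q :: nat
    proof (rule less.hyps)
      show "g [^] q \<in> nil G" using less.prems by (rule nil_pow_closed)
      show "ord (g [^] q) < ord g"
        using ord_pow[OF gG q(2)] q(1) ord0 prime_gt_1_nat[OF q(1)] by simp
    qed
    show ?case
    proof (cases "ord g = 1")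
      case True
      then show ?thesis using ord_eq_1[OF gG] Z.one_closed by simp
    next
      case False
      then obtain p where p: "prime p" "p dvd ord g" by (metis prime_factor_nat)
      show ?thesis
      proof (cases "\<exists>k. ord g = p ^ k")
        case True
        then show ?thesis using nil_prime_power_order_in_hypercenter[OF fin p(1) less.prems] by blast
      next
        case False
        then obtain q where "q \<in> prime_factors (ord g)" "q \<noteq> p"
          using Ex_other_prime_factor[of "ord g" p] ord0 p(1) by auto
        then have q: "prime q" "q dvd ord g" "q \<noteq> p" by (auto simp: in_prime_factors_iff)
        show ?thesis
          using Z.mem_of_coprime_pow_mem[OF gG prime_pow[OF p] prime_pow[OF q(1,2)]] p q
          by (simp add: primes_coprime)
      qed
    qed
  qed
qed

lemma (in group) hypercenter_subset_nil: "hypercenter G \<subseteq> nil G"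
proof
  fix g assume "g \<in> hypercenter G"
  then obtain n where g: "g \<in> upper_central_series G n" by (auto simp: hypercenter_def)
  have gG: "g \<in> carrier G" using g upper_central_series_subset by blast
  have "nilpotent (subgroup_generated G {g, h})" if h: "h \<in> carrier G" for h
  proof -
    let ?S = "subgroup_generated G {g, h}"
    interpret S: group ?S by (rule group_subgroup_generated)
    interpret W: normal "upper_central_series ?S n" ?S by (rule S.upper_central_series_normal)
    have mem: "g \<in> carrier ?S" "h \<in> carrier ?S"
      using gG h subgroup_generated_subset_carrier_subset[of "{g, h}"] by auto
    have gW: "g \<in> upper_central_series ?S n"
      using upper_central_series_Int_subgroup[OF subgroup_subgroup_generated, of n "{g, h}"] g mem
      by (auto simp: subgroup_generated_def)
    have generates: "carrier ?S \<subseteq> K" if "subgroup K ?S" "g \<in> K" "h \<in> K" for K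
      using S.subgroup_generated_minimal[OF that(1), of "{g, h}"] that by simp
    \<comment> \<open>Modulo the term of index \<open>n\<close>, which contains \<open>g\<close>, the generator \<open>h\<close> commutes with both
      generators, so it lies in the next term; hence that term is everything.\<close>
    let ?K = "{y \<in> carrier ?S. h \<otimes>\<^bsub>?S\<^esub> y \<otimes>\<^bsub>?S\<^esub> inv\<^bsub>?S\<^esub> h \<otimes>\<^bsub>?S\<^esub> inv\<^bsub>?S\<^esub> y
        \<in> upper_central_series ?S n}"
    have "g \<in> ?K"
      using W.commutator_mem_of_mem[OF gW mem(2)] W.commutator_mem_commute[OF mem] mem by blast
    moreover have "h \<otimes>\<^bsub>?S\<^esub> h \<otimes>\<^bsub>?S\<^esub> inv\<^bsub>?S\<^esub> h \<otimes>\<^bsub>?S\<^esub> inv\<^bsub>?S\<^esub> h = \<one>\<^bsub>?S\<^esub>"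
      using h mem by (simp add: m_assoc)
    then have "h \<in> ?K" using mem(2) W.one_closed by (simp only: mem_Collect_eq)
    ultimately have "carrier ?S \<subseteq> ?K"
      using generates W.centralizer_mod_subgroup[OF mem(2)] by blast
    then have "h \<in> upper_central_series ?S (Suc n)"
      unfolding upper_central_series.simps using mem(2) by blast
    moreover have "g \<in> upper_central_series ?S (Suc n)"
      using gW S.upper_central_series_mono[of n "Suc n"] le_SucI[OF order_refl] by blast
    ultimately have "carrier ?S \<subseteq> upper_central_series ?S (Suc n)"
      using generates[OF normal_imp_subgroup[OF S.upper_central_series_normal]] by blast
    then have "upper_central_series ?S (Suc n) = carrier ?S"
      using S.upper_central_series_subset by blast
    then show ?thesis unfolding nilpotent_def by blast
  qed
  then show "g \<in> nil G" using gG by (simp add: nil_def)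
qed

theorem (in group) nil_eq_hypercenter:
  assumes "finite (carrier G)"
  shows "nil G = hypercenter G"
  using assms nil_subset_hypercenter hypercenter_subset_nil by blast

section \<open>Commuting pairs and conjugate pairs\<close>

lemma (in group) centralizer_subgroup:
  assumes "A \<subseteq> carrier G"
  shows "subgroup {x \<in> carrier G. \<forall>a \<in> A. x \<otimes> a = a \<otimes> x} G"
proof (rule subgroupI)
  have "\<one> \<in> {x \<in> carrier G. \<forall>a \<in> A. x \<otimes> a = a \<otimes> x}" using assms by auto
  then show "{x \<in> carrier G. \<forall>a \<in> A. x \<otimes> a = a \<otimes> x} \<noteq> {}" by blast
next
  fix x assume "x \<in> {x \<in> carrier G. \<forall>a \<in> A. x \<otimes> a = a \<otimes> x}"
  then show "inv x \<in> {x \<in> carrier G. \<forall>a \<in> A. x \<otimes> a = a \<otimes> x}"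
    using assms commute_inv[of _ x] by (simp add: subset_iff)
next
  fix x y assume "x \<in> {x \<in> carrier G. \<forall>a \<in> A. x \<otimes> a = a \<otimes> x}"
    "y \<in> {x \<in> carrier G. \<forall>a \<in> A. x \<otimes> a = a \<otimes> x}"
  then show "x \<otimes> y \<in> {x \<in> carrier G. \<forall>a \<in> A. x \<otimes> a = a \<otimes> x}"
    using assms commute_mult[of _ x y] by (simp add: subset_iff)
qed auto

text \<open>
  In the centralizer of \<open>x\<close> the element \<open>x\<close> is central, hence hypercentral, and \<open>y\<close> belongs to that
  centralizer.
\<close>

lemma (in group) nilpotent_subgroup_generated_commuting:
  assumes x: "x \<in> carrier G" and y: "y \<in> carrier G" and xy: "x \<otimes> y = y \<otimes> x"
  shows "nilpotent (subgroup_generated G {x, y})"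
proof -
  let ?H = "{h \<in> carrier G. \<forall>a \<in> {x}. h \<otimes> a = a \<otimes> h}"
  have H: "subgroup ?H G" using centralizer_subgroup[of "{x}"] x by simp
  interpret H: group "G\<lparr>carrier := ?H\<rparr>" using H by (rule subgroup_imp_group)
  have mem: "x \<in> ?H" "y \<in> ?H" using x y xy by auto
  have "x \<otimes> h \<otimes> inv x \<otimes> inv\<^bsub>G\<lparr>carrier := ?H\<rparr>\<^esub> h = \<one>" if h: "h \<in> ?H" for h
  proof -
    have "x \<otimes> h = h \<otimes> x" using h by auto
    then have "x \<otimes> h \<otimes> inv x \<otimes> inv h = h \<otimes> x \<otimes> inv x \<otimes> inv h" by (simp only:)
    also have "\<dots> = \<one>" using subgroup.mem_carrier[OF H h] x by (simp add: m_assoc)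
    finally show ?thesis using m_inv_consistent[OF H h] by (simp only:)
  qed
  then have "x \<in> upper_central_series (G\<lparr>carrier := ?H\<rparr>) (Suc 0)"
    using mem(1) m_inv_consistent[OF H mem(1)] by simp
  then have "x \<in> nil (G\<lparr>carrier := ?H\<rparr>)"
    using H.hypercenter_subset_nil unfolding hypercenter_def by blast
  then have "nilpotent (subgroup_generated (G\<lparr>carrier := ?H\<rparr>) {x, y})"
    using mem(2) by (simp add: nil_def)
  moreover have "generate (G\<lparr>carrier := ?H\<rparr>) {x, y} = generate G {x, y}"
    using generate_consistent[OF _ H, of "{x, y}"] mem by simp
  then have "subgroup_generated (G\<lparr>carrier := ?H\<rparr>) {x, y} = subgroup_generated G {x, y}"
    using mem x y by (simp add: subgroup_generated_def)
  ultimately show ?thesis by simp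
qed

lemma (in group_hom) hom_image_upper_central_series:
  assumes "h ` carrier G = carrier H"
  shows "h ` upper_central_series G n \<subseteq> upper_central_series H n"
proof (induction n)
  case (Suc n)
  show ?case
  proof
    fix x' assume "x' \<in> h ` upper_central_series G (Suc n)"
    then obtain x where "x \<in> upper_central_series G (Suc n)" and x': "x' = h x" by blast
    then have x: "x \<in> carrier G" and xZ: "\<And>y. y \<in> carrier G \<Longrightarrow>
        x \<otimes>\<^bsub>G\<^esub> y \<otimes>\<^bsub>G\<^esub> inv\<^bsub>G\<^esub> x \<otimes>\<^bsub>G\<^esub> inv\<^bsub>G\<^esub> y \<in> upper_central_series G n"
      by simp_all
    have "h x \<otimes>\<^bsub>H\<^esub> y' \<otimes>\<^bsub>H\<^esub> inv\<^bsub>H\<^esub> h x \<otimes>\<^bsub>H\<^esub> inv\<^bsub>H\<^esub> y' \<in> upper_central_series H n"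
      if "y' \<in> carrier H" for y'
    proof -
      have "y' \<in> h ` carrier G" using that assms by simp
      then obtain y where y: "y \<in> carrier G" "y' = h y" by (elim imageE)
      have "h (x \<otimes>\<^bsub>G\<^esub> y \<otimes>\<^bsub>G\<^esub> inv\<^bsub>G\<^esub> x \<otimes>\<^bsub>G\<^esub> inv\<^bsub>G\<^esub> y) \<in> upper_central_series H n"
        by (rule subsetD[OF Suc imageI[OF xZ[OF y(1)]]])
      then show ?thesis using x y by simp
    qed
    then show "x' \<in> upper_central_series H (Suc n)" using x x' by simp
  qed
qed simp

lemma (in group_hom) nilpotent_hom_image:
  assumes "nilpotent G" "h ` carrier G = carrier H"
  shows "nilpotent H"
  using assms hom_image_upper_central_series[OF assms(2)] H.upper_central_series_subset
  unfolding nilpotent_def by (metis subset_antisym)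

lemma (in group) nilpotent_subgroup_generated_conjugate:
  assumes x: "x \<in> carrier G" and S: "S \<subseteq> carrier G" and nil: "nilpotent (subgroup_generated G S)"
  shows "nilpotent (subgroup_generated G ((\<lambda>y. x \<otimes> y \<otimes> inv x) ` S))"
proof -
  let ?f = "\<lambda>y. x \<otimes> y \<otimes> inv x"
  have hom: "?f (y \<otimes> z) = ?f y \<otimes> ?f z" if "y \<in> carrier G" "z \<in> carrier G" for y z
  proof -
    have "?f y \<otimes> ?f z = x \<otimes> y \<otimes> (inv x \<otimes> x) \<otimes> z \<otimes> inv x"
      using that x by (simp only: m_assoc inv_closed m_closed)
    then show ?thesis using that x by (simp add: m_assoc)
  qed
  interpret f: group_hom G G ?f
    by unfold_locales (use x hom in \<open>auto simp: hom_def\<close>)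
  have img: "?f ` generate G S = generate G (?f ` S)"
    using f.generate_img[OF S] by simp
  have Sf: "?f ` S \<subseteq> carrier G" using S x by auto
  have carrier: "carrier (subgroup_generated G S) = generate G S"
    "carrier (subgroup_generated G (?f ` S)) = generate G (?f ` S)"
    using S Sf by (simp_all add: carrier_subgroup_generated Int_absorb1)
  have "group_hom (subgroup_generated G S) (subgroup_generated G (?f ` S)) ?f"
    unfolding group_hom_def group_hom_axioms_def
    using img hom generate_in_carrier[OF S] by (auto simp: hom_def carrier)
  then show ?thesis
    using group_hom.nilpotent_hom_image nil img carrier by metis
qed

section \<open>Components of the nilpotent graph\<close>

context group
begin

context
  fixes C
  assumes fin: "finite (carrier G)" and C: "C \<in> nilpotent_components G"
begin

lemma component_subset: "C \<subseteq> carrier G - nil G"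
proof -
  interpret pair_graph "nilpotent_graph G" by (rule pair_graph_nilpotent_graph[OF fin])
  have "C \<in> sccs_verts" using C unfolding nilpotent_components_def sccs_verts_conv .
  then have "C \<subseteq> pverts (nilpotent_graph G)" using sccs_verts_subsets by simp
  then show ?thesis by (simp add: nilpotent_graph_def)
qed

lemma component_closed:
  assumes x: "x \<in> C" and y: "y \<in> carrier G - nil G" and xy: "nilpotent (subgroup_generated G {x, y})"
  shows "y \<in> C"
proof (cases "x = y")
  case False
  interpret pair_graph "nilpotent_graph G" by (rule pair_graph_nilpotent_graph[OF fin])
  have "C \<in> sccs_verts" using C unfolding nilpotent_components_def sccs_verts_conv .
  moreover have xG: "x \<in> carrier G - nil G" using x component_subset by blast
  then have "x \<rightarrow>\<^bsub>nilpotent_graph G\<^esub> y" "y \<rightarrow>\<^bsub>nilpotent_graph G\<^esub> x"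
    using x y xy False by (auto simp: nilpotent_graph_def insert_commute)
  then have "x \<rightarrow>\<^sup>*\<^bsub>nilpotent_graph G\<^esub> y" "y \<rightarrow>\<^sup>*\<^bsub>nilpotent_graph G\<^esub> x" by auto
  ultimately show ?thesis using x unfolding in_sccs_verts_conv_reachable by blast
qed (use x in simp)

text \<open>
  Two vertices of a component are joined by a path inside it, so a property that passes to
  neighbours in the component and holds at one vertex holds at all.
\<close>

lemma component_induct [consumes 2, case_names base step]:
  assumes x: "x \<in> C" and y: "y \<in> C" and base: "P x"
    and step: "\<And>u v. u \<in> C \<Longrightarrow> v \<in> C \<Longrightarrow> nilpotent (subgroup_generated G {u, v}) \<Longrightarrow> P u \<Longrightarrow> P v"
  shows "P y"
proof -
  interpret pair_graph "nilpotent_graph G" by (rule pair_graph_nilpotent_graph[OF fin])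
  have "C \<in> sccs_verts" using C unfolding nilpotent_components_def sccs_verts_conv .
  then have "x \<rightarrow>\<^sup>*\<^bsub>nilpotent_graph G\<^esub> y" using x y unfolding in_sccs_verts_conv_reachable by blast
  then have "y \<in> C \<and> P y"
  proof (induction rule: reachable_induct)
    case (step u v)
    then have "v \<in> carrier G - nil G" "nilpotent (subgroup_generated G {u, v})"
      by (auto simp: nilpotent_graph_def)
    then show ?case using step component_closed assms(4) by blast
  qed (use x base in simp)
  then show ?thesis ..
qed

text \<open>
  The product is a vertex because \<open>nil G\<close> is a subgroup. The subgroup generated by \<open>z\<close> and \<open>c\<close> is
  nilpotent and contains the product, which is therefore equal or adjacent to \<open>c\<close>.
\<close>

lemma component_mult_nil:
  assumes z: "z \<in> nil G" and c: "c \<in> C"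
  shows "z \<otimes> c \<in> C"
proof -
  interpret Z: normal "nil G" G using hypercenter_normal[OF fin] nil_eq_hypercenter[OF fin] by simp
  have zG: "z \<in> carrier G" and cG: "c \<in> carrier G" and c_nil: "c \<notin> nil G"
    using z c component_subset by auto
  have "z \<otimes> c \<notin> nil G"
  proof
    assume "z \<otimes> c \<in> nil G"
    then have "inv z \<otimes> (z \<otimes> c) \<in> nil G" using z by simp
    then show False using c_nil zG cG by (simp add: m_assoc[symmetric])
  qed
  moreover have "nilpotent (subgroup_generated G {c, z \<otimes> c})"
  proof (rule nilpotent_subgroup_generated_mono')
    show "nilpotent (subgroup_generated G {z, c})" using z cG unfolding nil_def by blast
    interpret S: group "subgroup_generated G {z, c}" by (rule group_subgroup_generated)
    have "z \<in> carrier (subgroup_generated G {z, c})" "c \<in> carrier (subgroup_generated G {z, c})"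
      using zG cG subgroup_generated_subset_carrier_subset[of "{z, c}"] by auto
    then show "{c, z \<otimes> c} \<subseteq> carrier (subgroup_generated G {z, c})"
      using S.m_closed[of z c] by simp
  qed
  ultimately show ?thesis using component_closed[OF c] zG cG by simp
qed

lemma card_nil_dvd_card_component_Un_nil: "card (nil G) dvd card (C \<union> nil G)"
proof -
  interpret Z: normal "nil G" G using hypercenter_normal[OF fin] nil_eq_hypercenter[OF fin] by simp
  have sub: "C \<union> nil G \<subseteq> carrier G" using component_subset nil_subset_carrier by blast
  let ?K = "(\<lambda>x. nil G #> x) ` (C \<union> nil G)"
  have K: "?K \<subseteq> rcosets (nil G)" using sub Z.subset by (auto intro: rcosetsI)
  have "\<Union>?K = C \<union> nil G"
  proof
    show "\<Union>?K \<subseteq> C \<union> nil G"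
      using component_mult_nil Z.m_closed by (auto simp: r_coset_def)
    show "C \<union> nil G \<subseteq> \<Union>?K"
      using rcos_self[OF _ Z.subgroup_axioms] sub by blast
  qed
  moreover have "card (nil G) dvd card (\<Union>?K)"
  proof (rule dvd_partition)
    have "finite (C \<union> nil G)" using sub fin by (rule finite_subset)
    with calculation show "finite (\<Union>?K)" by (simp only:)
    show "\<forall>R \<in> ?K. card (nil G) dvd card R"
      using K card_rcosets_equal[OF _ Z.subset] by auto
    show "\<forall>R \<in> ?K. \<forall>S \<in> ?K. R \<noteq> S \<longrightarrow> R \<inter> S = {}"
      using K rcos_disjoint[OF Z.subgroup_axioms] by (meson disjnt_def pairwiseD subsetD)
  qed
  ultimately show ?thesis by simp
qed

text \<open>
  For \<open>x\<close> in \<open>C\<close>, conjugation by \<open>x\<close> preserves adjacency and fixes the vertex \<open>x\<close>, so it maps the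
  component of \<open>x\<close> to itself. For \<open>x\<close> in \<open>nil G\<close>, the conjugate of \<open>c\<close> arises from \<open>c\<close> by
  multiplication with the element \<open>x c x\<^sup>-\<^sup>1 c\<^sup>-\<^sup>1\<close> of \<open>nil G\<close>.
\<close>

lemma component_conjugate:
  assumes x: "x \<in> C \<union> nil G" and c: "c \<in> C"
  shows "x \<otimes> c \<otimes> inv x \<in> C"
proof (cases "x \<in> C")
  case True
  interpret Z: normal "nil G" G using hypercenter_normal[OF fin] nil_eq_hypercenter[OF fin] by simp
  have xG: "x \<in> carrier G" using True component_subset by blast
  from True c show ?thesis
  proof (induction rule: component_induct)
    case base
    then show ?case using True xG by (simp add: m_assoc)
  next
    case (step u v)
    then have uv: "u \<in> carrier G" "v \<in> carrier G" "v \<notin> nil G" using component_subset by auto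
    have "x \<otimes> v \<otimes> inv x \<notin> nil G"
    proof
      assume "x \<otimes> v \<otimes> inv x \<in> nil G"
      then have "inv x \<otimes> (x \<otimes> v \<otimes> inv x) \<otimes> x \<in> nil G" using xG Z.inv_op_closed1 by blast
      moreover have "inv x \<otimes> (x \<otimes> v \<otimes> inv x) \<otimes> x = v" using xG uv by (simp add: m_assoc inv_solve_left')
      ultimately show False using uv by simp
    qed
    moreover have "nilpotent (subgroup_generated G {x \<otimes> u \<otimes> inv x, x \<otimes> v \<otimes> inv x})"
      using nilpotent_subgroup_generated_conjugate[OF xG, of "{u, v}"] step uv by simp
    ultimately show ?case using component_closed[OF step(4)] xG uv by simp
  qed
next
  case False
  then have x: "x \<in> nil G" using x by simp
  then have xG: "x \<in> carrier G" and cG: "c \<in> carrier G"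
    using nil_subset_carrier c component_subset by auto
  interpret Z: normal "nil G" G using hypercenter_normal[OF fin] nil_eq_hypercenter[OF fin] by simp
  have "c \<otimes> inv x \<otimes> inv c \<in> nil G" using x cG Z.inv_op_closed2 by simp
  then have "x \<otimes> (c \<otimes> inv x \<otimes> inv c) \<otimes> c \<in> C"
    using x c component_mult_nil Z.m_closed by blast
  then show ?thesis using xG cG by (simp add: m_assoc)
qed

lemma component_contains_centralizer:
  assumes c: "c \<in> C" and x: "x \<in> carrier G" and cx: "c \<otimes> x = x \<otimes> c"
  shows "x \<in> C \<union> nil G"
proof -
  have "c \<in> carrier G" using c component_subset by blast
  then have "nilpotent (subgroup_generated G {c, x})"
    using x cx by (rule nilpotent_subgroup_generated_commuting)
  then show ?thesis using component_closed[OF c, of x] x by blast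
qed

text \<open>
  Either \<open>P\<close> meets \<open>nil G\<close> nontrivially, and then the coset count applies, or \<open>P\<close> has an element \<open>z\<close>
  in \<open>C\<close>, and then the powers of \<open>z\<close> act on \<open>C \<union> nil G\<close> with the centralizer of \<open>z\<close> as set of fixed
  points. That the powers of \<open>z\<close> preserve \<open>C \<union> nil G\<close> uses that they all lie in \<open>P\<close>.
\<close>

lemma prime_dvd_card_component_Un_nil:
  assumes p: "prime p" "p dvd order G"
    and P: "sylow_subgroup G p P" "P \<subseteq> C \<union> nil G"
  shows "p dvd card (C \<union> nil G)"
proof -
  interpret Z: normal "nil G" G using hypercenter_normal[OF fin] nil_eq_hypercenter[OF fin] by simp
  have sub: "subgroup P G" and card: "card P = p ^ multiplicity p (order G)"
    using P(1) by (auto simp: sylow_subgroup_def)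
  interpret P: subgroup P G by (rule sub)
  have "order G \<noteq> 0" using fin order_gt_0_iff_finite by simp
  then have "multiplicity p (order G) \<noteq> 0"
    using p by (metis multiplicity_eq_zero_iff not_prime_unit)
  then have "p dvd card P" using card by simp
  then have "P \<noteq> {\<one>}" using p(1) by (metis card_1_singleton_iff One_nat_def not_prime_unit)
  then obtain z where z: "z \<in> P" "z \<noteq> \<one>" using P.one_closed by blast
  have zG: "z \<in> carrier G" using z(1) by (rule P.mem_carrier)
  have "ord z dvd p ^ multiplicity p (order G)"
    using ord_dvd_card_subgroup[OF sub z(1)] card by simp
  then obtain k where k: "ord z = p ^ k" using divides_primepow_nat[OF p(1)] by blast
  have "ord z \<noteq> 1" using ord_eq_1[OF zG] z(2) by simp
  then have p_ord: "p dvd ord z" using k by (cases k) auto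
  show ?thesis
  proof (cases "z \<in> nil G")
    case True
    then have "ord z dvd card (nil G)" using ord_dvd_card_subgroup[OF Z.subgroup_axioms] by blast
    then show ?thesis using p_ord card_nil_dvd_card_component_Un_nil by (meson dvd_trans)
  next
    case False
    then have zC: "z \<in> C" using z(1) P(2) by blast
    let ?S = "generate G {z}"
    let ?K = "{x \<in> carrier G. \<forall>s \<in> ?S. x \<otimes> s = s \<otimes> x}"
    have S: "subgroup ?S G" using generate_is_subgroup zG by simp
    have z_S: "z \<in> ?S" by (auto intro: generate.incl)
    have SP: "?S \<subseteq> P" using generate_subgroup_incl[of "{z}" P] z(1) sub by simp
    have "x \<in> C \<union> nil G" if "x \<in> ?K" for x
    proof (rule component_contains_centralizer[OF zC])
      show "x \<in> carrier G" using that by blast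
      have "x \<otimes> z = z \<otimes> x" using that z_S by blast
      then show "z \<otimes> x = x \<otimes> z" by (rule sym)
    qed
    then have "{x \<in> C \<union> nil G. \<forall>s \<in> ?S. x \<otimes> s = s \<otimes> x} = ?K"
      using component_subset nil_subset_carrier by blast
    moreover have "p dvd card ?K"
    proof -
      have "?S \<subseteq> {s \<in> carrier G. \<forall>y \<in> {z}. s \<otimes> y = y \<otimes> s}"
        using generate_subgroup_incl[OF _ centralizer_subgroup[of "{z}"]] zG by simp
      then have "z \<in> ?K" using zG by auto
      moreover have "subgroup ?K G" using centralizer_subgroup[OF subgroup.subset[OF S]] .
      ultimately have "ord z dvd card ?K" by (rule_tac ord_dvd_card_subgroup)
      with p_ord show ?thesis by (rule dvd_trans)
    qed
    moreover have "p dvd card (C \<union> nil G) \<longleftrightarrow>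
        p dvd card {x \<in> C \<union> nil G. \<forall>s \<in> ?S. x \<otimes> s = s \<otimes> x}"
    proof (rule prime_dvd_card_iff_dvd_card_centralized[OF p(1) S])
      show "card ?S = p ^ k" using generate_pow_card[OF zG] k by simp
      show E: "C \<union> nil G \<subseteq> carrier G" using component_subset nil_subset_carrier by blast
      show "finite (C \<union> nil G)" using finite_subset[OF E fin] .
      show "s \<otimes> x \<otimes> inv s \<in> C \<union> nil G" if "s \<in> ?S" "x \<in> C \<union> nil G" for s x
        using that SP P(2) component_conjugate[of s x] Z.inv_op_closed2[of s x] E by blast
    qed
    ultimately show ?thesis by simp
  qed
qed

text \<open>
  As \<open>1\<close> is a fixed point of a subgroup of order \<open>p\<close> acting on \<open>C \<union> {1}\<close>, a set whose size is
  divisible by \<open>p\<close>, there is a fixed point in \<open>C\<close>. It links the subgroup, and then a Sylow subgroup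
  above it, to \<open>C\<close>.
\<close>

lemma component_contains_sylow_subgroup:
  assumes p: "prime p" and nil: "nil G = {\<one>}"
    and C_dvd: "p dvd card C + 1" and N_dvd: "p dvd card (normalizer G C)"
  obtains P where "sylow_subgroup G p P" "P \<subseteq> C \<union> {\<one>}"
proof -
  have CG: "C \<subseteq> carrier G" "\<one> \<notin> C" using component_subset nil by auto
  interpret N: subgroup "normalizer G C" G by (rule normalizer_imp_subgroup[OF CG(1)])
  let ?N = "G\<lparr>carrier := normalizer G C\<rparr>"
  obtain m where "order ?N = p ^ 1 * m" using N_dvd by (auto simp: order_def elim: dvdE)
  moreover have "group ?N" "finite (carrier ?N)"
    using subgroup_imp_group[OF N.subgroup_axioms] finite_subset[OF N.subset fin] by auto
  ultimately obtain S where S_N: "subgroup S ?N" and S_card: "card S = p ^ 1"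
    using sylow_thm[OF p] by blast
  have S: "subgroup S G" using incl_subgroup[OF N.subgroup_axioms S_N] .
  have SN: "S \<subseteq> normalizer G C" using subgroup.subset[OF S_N] by simp
  have "S \<noteq> {\<one>}" using S_card prime_gt_1_nat[OF p] by auto
  then obtain s where s: "s \<in> S" "s \<noteq> \<one>" using subgroup.one_closed[OF S] by blast
  have sG: "s \<in> carrier G" using subgroup.mem_carrier[OF S s(1)] .
  let ?E = "insert \<one> C"
  let ?F = "{x \<in> ?E. \<forall>s \<in> S. x \<otimes> s = s \<otimes> x}"
  have "p dvd card ?E \<longleftrightarrow> p dvd card ?F"
  proof (rule prime_dvd_card_iff_dvd_card_centralized[OF p S S_card])
    show E: "?E \<subseteq> carrier G" using CG by simp
    show "finite ?E" using finite_subset[OF E fin] .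
    fix t x assume t: "t \<in> S" and x: "x \<in> ?E"
    have tG: "t \<in> carrier G" using subgroup.mem_carrier[OF S t] .
    have "t \<in> normalizer G C" using SN t by (rule subsetD)
    then have "(\<lambda>H \<in> {H. H \<subseteq> carrier G}. r_coset G (l_coset G t H) (inv t)) C = C"
      unfolding normalizer_def stabilizer_def by blast
    then have eq: "r_coset G (l_coset G t C) (inv t) = C"
      using CG(1) by (simp only: restrict_apply mem_Collect_eq if_True)
    show "t \<otimes> x \<otimes> inv t \<in> ?E"
    proof (cases "x = \<one>")
      case False
      then have "t \<otimes> x \<otimes> inv t \<in> r_coset G (l_coset G t C) (inv t)"
        using x unfolding l_coset_def r_coset_def by blast
      then show ?thesis unfolding eq by simp
    qed (use tG in simp)
  qed
  moreover have "card ?E = card C + 1" using CG finite_subset[OF CG(1) fin] by simp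
  ultimately have "p dvd card ?F" using C_dvd by simp
  then have "?F \<noteq> {\<one>}" using p by (metis card_1_singleton_iff One_nat_def not_prime_unit)
  moreover have "\<one> \<in> ?F" using subgroup.mem_carrier[OF S] by simp
  ultimately obtain c where "c \<in> ?F" "c \<noteq> \<one>" by blast
  then have c: "c \<in> C" "c \<otimes> s = s \<otimes> c" using s(1) by auto
  then have sC: "s \<in> C" using component_contains_centralizer[OF c(1) sG] nil s(2) by simp
  obtain P where P: "sylow_subgroup G p P" "S \<subseteq> P"
    using sylow_subgroup_containing_p_subgroup[OF fin p S S_card] .
  then have sub: "subgroup P G" and card: "card P = p ^ multiplicity p (order G)"
    by (auto simp: sylow_subgroup_def)
  interpret PG: group "G\<lparr>carrier := P\<rparr>" using sub by (rule subgroup_imp_group)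
  have nilP: "nilpotent (G\<lparr>carrier := P\<rparr>)"
    using PG.p_group_nilpotent[OF p] card by (simp add: order_def)
  have "y \<in> C" if y: "y \<in> P" "y \<noteq> \<one>" for y
  proof (rule component_closed[OF sC])
    show "y \<in> carrier G - nil G" using y nil subgroup.mem_carrier[OF sub] by simp
    have "{s, y} \<subseteq> P" using s(1) P(2) y(1) by blast
    then show "nilpotent (subgroup_generated G {s, y})"
      by (rule nilpotent_subgroup_generated_mono[OF nilP sub])
  qed
  then have "P \<subseteq> C \<union> {\<one>}" by blast
  with P(1) show ?thesis by (rule that)
qed

end

end

theorem theorem6p3:
  fixes G :: "('a, 'b) monoid_scheme" and C :: "'a set" and p :: nat
  assumes "group G" and "finite (carrier G)" and "\<not> nilpotent G"
    and "C \<in> nilpotent_components G"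
    and "prime p" and "p dvd order G"
  shows "(\<forall>P. sylow_subgroup G p P \<and> P \<subseteq> C \<union> hypercenter G \<longrightarrow>
            p dvd card (C \<union> hypercenter G)) \<and>
         (p dvd gcd (card C + 1) (card (normalizer G C)) \<and> hypercenter G = {\<one>\<^bsub>G\<^esub>} \<longrightarrow>
            (\<exists>P. sylow_subgroup G p P \<and> P \<subseteq> C \<union> {\<one>\<^bsub>G\<^esub>}))"
proof -
  interpret group G by fact
  note fin = assms(2) and C = assms(4)
  have nil: "nil G = hypercenter G" by (rule nil_eq_hypercenter[OF fin])
  show ?thesis
  proof (intro conjI allI impI)
    fix P assume "sylow_subgroup G p P \<and> P \<subseteq> C \<union> hypercenter G"
    then show "p dvd card (C \<union> hypercenter G)"
      using prime_dvd_card_component_Un_nil[OF fin C assms(5,6), of P] unfolding nil by blast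
  next
    assume *: "p dvd gcd (card C + 1) (card (normalizer G C)) \<and> hypercenter G = {\<one>\<^bsub>G\<^esub>}"
    then have "nil G = {\<one>\<^bsub>G\<^esub>}" "p dvd card C + 1" "p dvd card (normalizer G C)"
      using nil by auto
    then obtain P where "sylow_subgroup G p P" "P \<subseteq> C \<union> {\<one>\<^bsub>G\<^esub>}"
      by (rule component_contains_sylow_subgroup[OF fin C assms(5)])
    then show "\<exists>P. sylow_subgroup G p P \<and> P \<subseteq> C \<union> {\<one>\<^bsub>G\<^esub>}" by blast
  qed
qed

end
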